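(* Let $m,n$ be coprime integers with $1\le m\le n-1$, and let $\gamma_0(x)=(\cos 2\pi x,\sin2\pi x)$ parametrize the unit circle. For every $\rho>0$ and every $\varepsilon>0$ there is a $1$-periodic real-analytic map $\gamma:\mathbb{R}\to\mathbb{R}^2$ with the following properties: - $\gamma$ extends holomorphically to the strip $\mathbb{R}+i[-\rho,\rho]$ with $\sup_{x\in\mathbb{R}+i[-\rho,\rho]}\|\gamma(x)-\gamma_0(x)\|<\varepsilon$; - $\gamma$ parametrizes a simple closed curve $\Gamma$ bounding a strictly convex domain; - $\Gamma$ admits infinitely many non-Birkhoff periodic billiard orbits of rotation number $\frac mn$.
   Context: A billiard orbit on $\Gamma$ is a sequence $z\in\Gamma^{\mathbb{Z}}$ with $z_i\ne z_{i+1}$ such that the reflection law (angle of incidence equals angle of reflection with respect to the tangent at $z_i$) holds at every $z_i$. A lift $x$ satisfies $\gamma(x_i)=z_i$ and $0<x_{i+1}-x_i<1$. The rotation number is $\lim x_i/i$. A billiard orbit is Birkhoff if its lift satisfies $x_i\le x_j+l\Rightarrow x_{i+m}\le x_{j+m}+l$ for all integers $i,j,l,m$, and non-Birkhoff otherwise. *)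

theory Defs
  imports "HOL-Analysis.Analysis"
begin

definition reflection_law ::
  "(real \<Rightarrow> real \<times> real) \<Rightarrow> real \<Rightarrow> real \<times> real \<Rightarrow> real \<times> real \<Rightarrow> bool" where
  "reflection_law \<gamma> s zprev znext \<longleftrightarrow>
     (let z = \<gamma> s; t = vector_derivative \<gamma> (at s) in
        inner (sgn (z - zprev)) t = inner (sgn (znext - z)) t)"

definition billiard_orbit :: "(real \<Rightarrow> real \<times> real) \<Rightarrow> (int \<Rightarrow> real \<times> real) \<Rightarrow> bool" where
  "billiard_orbit \<gamma> z \<longleftrightarrow>
     (\<forall>i. z i \<in> range \<gamma>) \<and> (\<forall>i. z i \<noteq> z (i + 1)) \<and>
     (\<forall>i s. \<gamma> s = z i \<longrightarrow> reflection_law \<gamma> s (z (i - 1)) (z (i + 1)))"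

definition is_lift :: "(real \<Rightarrow> real \<times> real) \<Rightarrow> (int \<Rightarrow> real \<times> real) \<Rightarrow> (int \<Rightarrow> real) \<Rightarrow> bool" where
  "is_lift \<gamma> z x \<longleftrightarrow> (\<forall>i. \<gamma> (x i) = z i \<and> 0 < x (i + 1) - x i \<and> x (i + 1) - x i < 1)"

definition has_rotation_number :: "(int \<Rightarrow> real) \<Rightarrow> real \<Rightarrow> bool" where
  "has_rotation_number x r \<longleftrightarrow> ((\<lambda>k::nat. x (int k) / real k) \<longlongrightarrow> r) sequentially"

definition birkhoff_lift :: "(int \<Rightarrow> real) \<Rightarrow> bool" where
  "birkhoff_lift x \<longleftrightarrow>
     (\<forall>i j l m :: int. x i \<le> x j + of_int l \<longrightarrow> x (i + m) \<le> x (j + m) + of_int l)"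

definition periodic_seq :: "(int \<Rightarrow> 'a) \<Rightarrow> bool" where
  "periodic_seq z \<longleftrightarrow> (\<exists>p::int. p > 0 \<and> (\<forall>i. z (i + p) = z i))"

definition nonbirkhoff_periodic_orbit ::
  "(real \<Rightarrow> real \<times> real) \<Rightarrow> real \<Rightarrow> (int \<Rightarrow> real \<times> real) \<Rightarrow> bool" where
  "nonbirkhoff_periodic_orbit \<gamma> r z \<longleftrightarrow>
     billiard_orbit \<gamma> z \<and> periodic_seq z \<and>
     (\<exists>x. is_lift \<gamma> z x \<and> has_rotation_number x r \<and> \<not> birkhoff_lift x)"

definition strictly_convex_domain :: "(real \<times> real) set \<Rightarrow> bool" where
  "strictly_convex_domain D \<longleftrightarrow> open D \<and> bounded D \<and> D \<noteq> {} \<and> convex D \<and>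
     (\<forall>p\<in>closure D. \<forall>q\<in>closure D. p \<noteq> q \<longrightarrow> open_segment p q \<subseteq> D)"

definition bounds_strictly_convex_domain :: "(real \<Rightarrow> real \<times> real) \<Rightarrow> bool" where
  "bounds_strictly_convex_domain \<gamma> \<longleftrightarrow>
     (\<forall>x. \<gamma> (x + 1) = \<gamma> x) \<and> continuous_on UNIV \<gamma> \<and> inj_on \<gamma> {0..<1} \<and>
     (\<forall>x. \<gamma> differentiable (at x) \<and> vector_derivative \<gamma> (at x) \<noteq> 0) \<and>
     (\<exists>D. strictly_convex_domain D \<and> frontier D = \<gamma> ` {0..1})"

definition strip :: "real \<Rightarrow> complex set" where
  "strip \<rho> = {w. \<bar>Im w\<bar> \<le> \<rho>}"

definition holo_close_to_circle :: "(real \<Rightarrow> real \<times> real) \<Rightarrow> real \<Rightarrow> real \<Rightarrow> bool" where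
  "holo_close_to_circle \<gamma> \<rho> \<epsilon> \<longleftrightarrow>
     (\<exists>U G1 G2. open U \<and> strip \<rho> \<subseteq> U \<and> G1 holomorphic_on U \<and> G2 holomorphic_on U \<and>
        (\<forall>x::real. G1 (complex_of_real x) = complex_of_real (fst (\<gamma> x)) \<and>
                   G2 (complex_of_real x) = complex_of_real (snd (\<gamma> x))) \<and>
        (\<exists>\<delta> < \<epsilon>. \<forall>w\<in>strip \<rho>.
            sqrt ((cmod (G1 w - cos (2 * of_real pi * w)))\<^sup>2 +
                  (cmod (G2 w - sin (2 * of_real pi * w)))\<^sup>2) \<le> \<delta>))"

end

theory Submission
  imports Defs
begin

text \<open>The curve is the envelope of the lines at distance \<open>1 - e * cos (N * \<phi>)\<close> from the origin with
  normal angle \<open>\<phi>\<close>, where \<open>N = n\<close>. It has the symmetries of the regular \<open>N\<close>-gon, so the star polygon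
  \<open>x\<^sub>i = i * m / N\<close> is a billiard orbit, and for \<open>e > 0\<close> this orbit is elliptic: in the family of
  orbits with \<open>x\<^sub>0 = 0\<close>, \<open>x\<^sub>1 = t\<close>, the derivative of \<open>x\<^sub>K\<close> at the star polygon is
  \<open>sin (K * \<theta>) / sin \<theta>\<close>, where \<open>e\<close> is chosen so that \<open>\<theta> / \<pi>\<close> is irrational. If
  \<open>sin (K * \<theta>) < 0\<close> then \<open>x\<^sub>K\<close> first falls behind \<open>K * m / N\<close> as \<open>t\<close> grows, but overtakes it when \<open>t\<close> is
  almost a full turn; at an intermediate \<open>t\<close> the orbit meets a symmetry axis, so reflecting it
  yields a periodic orbit. It is not Birkhoff when \<open>K \<equiv> 1\<close> modulo \<open>N\<close>. Finitely many such orbits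
  are excluded by taking \<open>K - 1\<close> to be a common period: each of them has \<open>x\<^sub>K > K * m / N\<close>.\<close>

section \<open>Trigonometric preliminaries\<close>

lemma one_minus_cos_mult_le:
  fixes s :: real
  shows "\<bar>sin (real k * s / 2)\<bar> \<le> real k * \<bar>sin (s / 2)\<bar>"
proof (induction k)
  case (Suc k)
  have "sin (real (Suc k) * s / 2) = sin (real k * s / 2) * cos (s / 2) + cos (real k * s / 2) * sin (s / 2)"
    by (simp add: distrib_right add_divide_distrib add.commute sin_add)
  also have "\<bar>\<dots>\<bar> \<le> \<bar>sin (real k * s / 2)\<bar> * 1 + 1 * \<bar>sin (s / 2)\<bar>"
    by (intro order_trans[OF abs_triangle_ineq] add_mono) (auto simp: abs_mult intro!: mult_left_le mult_left_le_one_le)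
  also have "\<dots> \<le> real (Suc k) * \<bar>sin (s / 2)\<bar>"
    using Suc by (simp add: algebra_simps)
  finally show ?case .
qed simp

lemma one_minus_cos_nat_mult_le:
  fixes s :: real
  shows "1 - cos (real k * s) \<le> (real k)\<^sup>2 * (1 - cos s)"
proof -
  have half: "1 - cos x = 2 * (sin (x / 2))\<^sup>2" for x :: real
    using cos_double_sin[of "x / 2"] by simp
  have "(sin (real k * s / 2))\<^sup>2 \<le> (real k * \<bar>sin (s / 2)\<bar>)\<^sup>2"
    using power_mono[OF one_minus_cos_mult_le[of k s], of 2] by simp
  then show ?thesis
    by (simp add: half power_mult_distrib)
qed

text \<open>The terms linear in \<open>sin s\<close> cancel, so the error is of second order. As in
  the preceding lemma it is measured by \<open>1 - cos s\<close>, the value of \<open>nb\<close> on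
  the unit circle, so that the perturbation of \<open>nb\<close> stays relatively small as
  \<open>s\<close> tends to 0.\<close>

lemma sin_nat_mult_diff_le:
  fixes s :: real
  shows "\<bar>sin (real k * s) - real k * sin s\<bar> \<le> (real k)^3 * (1 - cos s)"
proof (induction k)
  case (Suc k)
  have "sin (real (Suc k) * s) = sin (real k * s) * cos s + cos (real k * s) * sin s"
    by (simp add: distrib_right add.commute sin_add)
  then have "sin (real (Suc k) * s) - real (Suc k) * sin s =
      (sin (real k * s) - real k * sin s) + (sin (real k * s) * (- (1 - cos s)) + (- (1 - cos (real k * s))) * sin s)"
    by (simp add: algebra_simps)
  also have "\<bar>\<dots>\<bar> \<le> (real k)^3 * (1 - cos s) + (1 * (1 - cos s) + (real k)\<^sup>2 * (1 - cos s) * 1)"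
  proof (intro order_trans[OF abs_triangle_ineq] add_mono Suc)
    show "\<bar>sin (real k * s) * - (1 - cos s)\<bar> \<le> 1 * (1 - cos s)"
      unfolding abs_mult by (intro mult_mono) auto
    show "\<bar>- (1 - cos (real k * s)) * sin s\<bar> \<le> (real k)\<^sup>2 * (1 - cos s) * 1"
      unfolding abs_mult
      by (intro mult_mono) (use one_minus_cos_nat_mult_le[of k s] in auto)
  qed
  also have "\<dots> = ((real k)^3 + 1 + (real k)\<^sup>2) * (1 - cos s)"
    by (simp add: algebra_simps)
  also have "\<dots> \<le> (real (Suc k))^3 * (1 - cos s)"
    by (intro mult_right_mono) (auto simp: power3_eq_cube power2_eq_square algebra_simps)
  finally show ?case .
qed simp

lemma cos_less_one:
  fixes s :: real
  assumes "0 < s" "s < 2 * pi"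
  shows "cos s < 1"
proof -
  have "cos s \<noteq> 1"
  proof
    assume "cos s = 1"
    then obtain k :: int where k: "s = of_int k * 2 * pi"
      using cos_one_2pi_int by blast
    with assms have "0 < k" "of_int k < (1::real)"
      by (auto simp: zero_less_mult_iff)
    then show False by simp
  qed
  then show ?thesis using cos_le_one[of s] by linarith
qed

text \<open>If every term were nonnegative, the bounded partial sums of the sines of an arithmetic
  progression would make the series converge and its terms tend to 0. But two consecutive sines
  cannot both be small when \<open>sin \<beta>\<close> is not 0.\<close>

lemma sin_progression_neg:
  fixes \<theta> :: real
  assumes irr: "\<And>j::nat. 0 < j \<Longrightarrow> sin (real j * \<theta>) \<noteq> 0" and "0 < M"
  shows "\<exists>k::nat. sin (real (1 + M * k) * \<theta>) < 0"
proof (rule ccontr)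
  assume "\<not> ?thesis"
  define \<beta> where "\<beta> = real M * \<theta>"
  define f where "f k = sin (\<theta> + real k * \<beta>)" for k :: nat
  have "sin (real (1 + M * k) * \<theta>) = f k" for k
    by (simp add: f_def \<beta>_def algebra_simps)
  with \<open>\<not> ?thesis\<close> have nonneg: "0 \<le> f k" for k
    by (metis not_le)
  have sb: "sin \<beta> \<noteq> 0"
    using irr \<open>0 < M\<close> by (simp add: \<beta>_def)
  have "sin \<beta> = 2 * sin (\<beta> / 2) * cos (\<beta> / 2)"
    using sin_double[of "\<beta> / 2"] by simp
  with sb have sh: "sin (\<beta> / 2) \<noteq> 0" by auto
  \<comment> \<open>Multiplication by \<open>2 * sin (\<beta> / 2)\<close> turns each sine into a
    difference of cosines half a step apart, so the sum telescopes.\<close>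
  have tele: "(\<Sum>k<L. f k) * (2 * sin (\<beta> / 2)) =
      cos (\<theta> - \<beta> / 2) - cos (\<theta> + (real L - 1/2) * \<beta>)" for L
  proof (induction L)
    case (Suc L)
    have "f L * (2 * sin (\<beta> / 2)) = cos (\<theta> + real L * \<beta> - \<beta> / 2) - cos (\<theta> + real L * \<beta> + \<beta> / 2)"
      by (simp add: f_def cos_add cos_diff)
    with Suc show ?case
      by (simp add: algebra_simps)
  qed simp
  have "(\<Sum>k<L. f k) \<le> 2 / \<bar>2 * sin (\<beta> / 2)\<bar>" for L
  proof -
    have "\<bar>(\<Sum>k<L. f k) * (2 * sin (\<beta> / 2))\<bar> \<le> 2"
      unfolding tele using abs_cos_le_one[of "\<theta> - \<beta> / 2"] abs_cos_le_one[of "\<theta> + (real L - 1/2) * \<beta>"]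
      by linarith
    then have "\<bar>\<Sum>k<L. f k\<bar> * \<bar>2 * sin (\<beta> / 2)\<bar> \<le> 2"
      by (simp add: abs_mult)
    then have "\<bar>\<Sum>k<L. f k\<bar> \<le> 2 / \<bar>2 * sin (\<beta> / 2)\<bar>"
      using sh by (simp add: pos_le_divide_eq)
    then show ?thesis by linarith
  qed
  then have "summable f"
    by (intro bounded_imp_summable[of f "2 / \<bar>2 * sin (\<beta> / 2)\<bar>"])
      (simp_all only: nonneg lessThan_Suc_atMost[symmetric])
  then have lim: "f \<longlonglongrightarrow> 0"
    by (rule summable_LIMSEQ_zero)
  have "(\<lambda>k. (f (Suc k) - f k * cos \<beta>)\<^sup>2 + (f k * sin \<beta>)\<^sup>2) \<longlonglongrightarrow> (0 - 0 * cos \<beta>)\<^sup>2 + (0 * sin \<beta>)\<^sup>2"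
    by (intro tendsto_intros lim LIMSEQ_Suc)
  \<comment> \<open>Two consecutive terms determine sine and cosine of the phase up to the factor
    \<open>sin \<beta>\<close>, so this combination is constant although both terms tend to
    0.\<close>
  moreover have "(f (Suc k) - f k * cos \<beta>)\<^sup>2 + (f k * sin \<beta>)\<^sup>2 = (sin \<beta>)\<^sup>2" for k
  proof -
    have "f (Suc k) - f k * cos \<beta> = cos (\<theta> + real k * \<beta>) * sin \<beta>"
      by (simp add: f_def sin_add[of "\<theta> + real k * \<beta>" \<beta>, symmetric] algebra_simps)
        (simp add: sin_add[of "\<theta> + real k * \<beta>" \<beta>, symmetric] sin_add algebra_simps)
    then show ?thesis
      by (simp add: f_def power_mult_distrib flip: distrib_right)
  qed
  ultimately show False
    using sb by (simp add: LIMSEQ_const_iff)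
qed

text \<open>The forbidden angles are rational multiples of \<open>pi\<close>, hence countable. Pairs
  with \<open>j = 0\<close> only contribute the value 0, which lies outside the interval.\<close>

lemma ex_small_nonresonant_angle:
  assumes "(0::real) < d"
  shows "\<exists>\<theta>. 0 < \<theta> \<and> \<theta> < d \<and> (\<forall>j::nat. 0 < j \<longrightarrow> sin (real j * \<theta>) \<noteq> 0)"
proof -
  define C where "C = (\<lambda>(i::int, j::nat). of_int i * pi / real j) ` UNIV"
  have "countable C" unfolding C_def by simp
  moreover have "uncountable {0<..<d}"
    using assms by (simp add: uncountable_open_interval)
  ultimately obtain \<theta> where \<theta>: "\<theta> \<in> {0<..<d}" "\<theta> \<notin> C"
    by (meson countable_subset subsetI)
  have "sin (real j * \<theta>) \<noteq> 0" if "0 < j" for j :: nat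
  proof
    assume "sin (real j * \<theta>) = 0"
    then obtain i :: int where "real j * \<theta> = of_int i * pi"
      using sin_zero_iff_int2 by blast
    then have "\<theta> = of_int i * pi / real j"
      using that by (simp add: field_simps)
    then have "\<theta> \<in> C" unfolding C_def by (auto intro!: image_eqI[of _ _ "(i, j)"])
    with \<theta> show False by simp
  qed
  with \<theta> show ?thesis by auto
qed

lemma cos_add_2pi_int: "cos (x + 2 * pi * of_int k) = cos x"
  and sin_add_2pi_int: "sin (x + 2 * pi * of_int k) = sin x" for x :: real
  by (simp_all add: cos_add sin_add)

lemma norm_cos_sin_le:
  fixes w :: complex
  shows "cmod (cos w) \<le> exp \<bar>Im w\<bar>" "cmod (sin w) \<le> exp \<bar>Im w\<bar>"
proof -
  have e: "cmod (exp (\<i> * w)) \<le> exp \<bar>Im w\<bar>" "cmod (exp (- (\<i> * w))) \<le> exp \<bar>Im w\<bar>"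
    by (simp_all add: norm_exp_eq_Re)
  show "cmod (cos w) \<le> exp \<bar>Im w\<bar>"
    using order_trans[OF norm_triangle_ineq add_mono[OF e]]
    by (simp add: cos_exp_eq norm_divide del: norm_exp_eq_Re)
  show "cmod (sin w) \<le> exp \<bar>Im w\<bar>"
    using order_trans[OF norm_triangle_ineq4 add_mono[OF e]]
    by (simp add: sin_exp_eq norm_divide norm_mult del: norm_exp_eq_Re)
qed

lemma ex_angle_in_period:
  fixes \<phi> :: real
  obtains \<psi> k where "0 \<le> \<psi>" "\<psi> < 2 * pi" "\<phi> = \<psi> + 2 * pi * of_int k"
proof
  define y where "y = \<phi> / (2 * pi)"
  show "0 \<le> 2 * pi * frac y" by simp
  show "2 * pi * frac y < 2 * pi" using frac_lt_1[of y] by simp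
  have "\<phi> = 2 * pi * y" by (simp add: y_def)
  then show "\<phi> = 2 * pi * frac y + 2 * pi * of_int \<lfloor>y\<rfloor>"
    by (simp add: frac_def algebra_simps)
qed

text \<open>A Birkhoff lift preserves the comparison of \<open>X (i + n)\<close> with
  \<open>X i + m\<close> under all shifts of the index. A strict inequality would therefore
  accumulate over \<open>P\<close> steps and contradict the period.\<close>

lemma birkhoff_lift_shift:
  assumes "birkhoff_lift X" and per: "\<And>i. X (i + int P * n) = X i + of_int (int P * m)" and "0 < P"
  shows "X (i + n) = X i + of_int m"
proof -
  have B: "X i \<le> X j + of_int l \<Longrightarrow> X (i + k) \<le> X (j + k) + of_int l" for i j l k
    using assms(1) unfolding birkhoff_lift_def by blast
  obtain P' where P': "P = Suc P'" using \<open>0 < P\<close> by (cases P) auto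
  show ?thesis
  proof (cases "X (i + n) \<le> X i + of_int m")
    case True
    \<comment> \<open>Starting at \<open>i + n\<close> leaves \<open>P' = P - 1\<close> steps to the
      end of the period; together they give the inequality opposite to the assumed one.\<close>
    have "X (i + n + int j * n) \<le> X (i + n) + of_int (int j * m)" for j
    proof (induction j)
      case (Suc j)
      have "X (i + n + (n + int j * n)) \<le> X (i + (n + int j * n)) + of_int m"
        by (rule B[OF True])
      with Suc show ?case by (simp add: algebra_simps)
    qed simp
    from this[of P'] per[of i] True show ?thesis by (simp add: P' algebra_simps)
  next
    case False
    then have F: "X i \<le> X (i + n) + of_int (- m)" by simp
    have "X (i + n) \<le> X (i + n + int j * n) + of_int (- int j * m)" for j
    proof (induction j)
      case (Suc j)
      have "X (i + (n + int j * n)) \<le> X (i + n + (n + int j * n)) + of_int (- m)"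
        by (rule B[OF F])
      with Suc show ?case by (simp add: algebra_simps)
    qed simp
    from this[of P'] per[of i] False show ?thesis by (simp add: P' algebra_simps)
  qed
qed

section \<open>The curve\<close>

text \<open>The factor in \<open>e_small\<close> is the one that the perturbation estimate for
  \<open>nb\<close> produces; it also keeps the radius of curvature positive.\<close>

locale flower =
  fixes N :: nat and m :: int and e :: real
  assumes m_pos: "1 \<le> m" and m_less: "m < int N"
    and e_pos: "0 < e" and e_small: "e * (real N ^ 3 + real N ^ 2 + 1) \<le> 1 / 2"
begin

text \<open>\<open>h\<close> is the support function in direction
  \<open>(cos \<phi>, sin \<phi>)\<close>, \<open>h'\<close> its derivative, and \<open>R\<close>,
  the sum of \<open>h\<close> and its second derivative, is the radius of curvature.
  \<open>Gam\<close> is parametrised by its normal angle.\<close>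

definition h :: "real \<Rightarrow> real" where "h \<phi> = 1 - e * cos (real N * \<phi>)"
definition h' :: "real \<Rightarrow> real" where "h' \<phi> = e * real N * sin (real N * \<phi>)"
definition R :: "real \<Rightarrow> real" where "R \<phi> = 1 + e * ((real N)\<^sup>2 - 1) * cos (real N * \<phi>)"
definition Gam :: "real \<Rightarrow> real \<times> real" where
  "Gam \<phi> = (h \<phi> * cos \<phi> - h' \<phi> * sin \<phi>, h \<phi> * sin \<phi> + h' \<phi> * cos \<phi>)"
text \<open>Tangential and inward normal components at \<open>Gam \<phi>\<close> of the chord to \<open>Gam \<psi>\<close>.\<close>

definition ta :: "real \<Rightarrow> real \<Rightarrow> real" where
  "ta \<phi> \<psi> = h \<psi> * sin (\<psi> - \<phi>) + h' \<psi> * cos (\<psi> - \<phi>) - h' \<phi>"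
definition nb :: "real \<Rightarrow> real \<Rightarrow> real" where
  "nb \<phi> \<psi> = h \<phi> - h \<psi> * cos (\<psi> - \<phi>) + h' \<psi> * sin (\<psi> - \<phi>)"
definition Q :: "real \<Rightarrow> real \<Rightarrow> real" where "Q \<phi> \<psi> = ta \<phi> \<psi> / nb \<phi> \<psi>"

lemma N_ge: "2 \<le> real N" using m_pos m_less by linarith

lemma e_half: "e * (real N)\<^sup>2 \<le> 1/2" "e \<le> 1/2" "e * real N \<le> 1/2"
proof -
  have "0 \<le> real N ^ 3" by simp
  moreover have "real N \<le> real N ^ 2" using N_ge by (simp add: power2_eq_square)
  ultimately have "real N \<le> real N ^ 3 + real N ^ 2 + 1" "real N ^ 2 \<le> real N ^ 3 + real N ^ 2 + 1"
    "1 \<le> real N ^ 3 + real N ^ 2 + 1"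
    by (linarith, linarith, simp)
  then have "e * (real N)\<^sup>2 \<le> e * (real N ^ 3 + real N ^ 2 + 1)" "e * 1 \<le> e * (real N ^ 3 + real N ^ 2 + 1)"
    "e * real N \<le> e * (real N ^ 3 + real N ^ 2 + 1)"
    using e_pos by (intro mult_left_mono; simp)+
  with e_small show "e * (real N)\<^sup>2 \<le> 1/2" "e \<le> 1/2" "e * real N \<le> 1/2" by linarith+
qed

lemma R_pos: "0 < R \<phi>"
proof -
  have N1: "0 \<le> e * ((real N)\<^sup>2 - 1)"
    using one_le_power[of "real N" 2] N_ge e_pos by simp
  have "\<bar>e * ((real N)\<^sup>2 - 1) * cos (real N * \<phi>)\<bar> \<le> e * ((real N)\<^sup>2 - 1) * 1"
    unfolding abs_mult[of _ "cos _"] using N1 by (intro mult_mono) auto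
  also have "\<dots> < 1" using e_half(1) e_pos by (simp add: algebra_simps)
  finally show ?thesis unfolding R_def by linarith
qed

lemma h_bounds: "1/2 \<le> h \<phi>" "h \<phi> \<le> 3/2"
proof -
  have "\<bar>e * cos (real N * \<phi>)\<bar> \<le> 1/2 * 1"
    unfolding abs_mult using e_half e_pos by (intro mult_mono) auto
  then show "1/2 \<le> h \<phi>" "h \<phi> \<le> 3/2" unfolding h_def by linarith+
qed

lemma h'_bound: "\<bar>h' \<phi>\<bar> \<le> 1/2"
proof -
  have "\<bar>h' \<phi>\<bar> \<le> (e * real N) * 1"
    unfolding h'_def abs_mult[of _ "sin _"] using e_pos by (intro mult_mono) auto
  with e_half show ?thesis by linarith
qed

lemma DERIV_h [derivative_intros]:
  assumes "(f has_field_derivative d) (at x within A)"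
  shows "((\<lambda>x. h (f x)) has_field_derivative h' (f x) * d) (at x within A)"
  unfolding h_def h'_def by (auto intro!: derivative_eq_intros assms)

lemma DERIV_h' [derivative_intros]:
  assumes "(f has_field_derivative d) (at x within A)"
  shows "((\<lambda>x. h' (f x)) has_field_derivative (R (f x) - h (f x)) * d) (at x within A)"
  unfolding h_def h'_def R_def
  by (auto intro!: derivative_eq_intros assms simp: algebra_simps power2_eq_square)

text \<open>For the unit circle \<open>nb\<close> equals \<open>1 - cos (\<psi> - \<phi>)\<close>,
  and the terms with the factor \<open>e\<close> cost at most half of that. This is strict convexity
  in quantitative form.\<close>

lemma nb_lower: "1 - cos (\<psi> - \<phi>) \<le> 2 * nb \<phi> \<psi>"
proof -
  define s where "s = \<phi> - \<psi>"
  have \<phi>: "\<phi> = \<psi> + s" by (simp add: s_def)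
  define c where "c = cos (real N * \<psi>)"
  define d where "d = sin (real N * \<psi>)"
  have cs: "0 \<le> 1 - cos s" by simp
  have hs: "h (\<psi> + s) = 1 - e * (c * cos (real N * s) - d * sin (real N * s))"
    by (simp add: h_def c_def d_def distrib_left cos_add)
  have hp: "h \<psi> = 1 - e * c" "h' \<psi> = e * real N * d"
    by (simp_all add: h_def h'_def c_def d_def)
  have nb: "nb \<phi> \<psi> = (1 - cos s) - e * (c * (cos (real N * s) - cos s) - d * (sin (real N * s) - real N * sin s))"
    unfolding \<phi> nb_def hs hp by (simp add: algebra_simps)
  have "\<bar>c * (cos (real N * s) - cos s) - d * (sin (real N * s) - real N * sin s)\<bar>
      \<le> \<bar>c * (cos (real N * s) - cos s)\<bar> + \<bar>d * (sin (real N * s) - real N * sin s)\<bar>"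
    by (rule abs_triangle_ineq4)
  also have "\<dots> \<le> 1 * (((real N)\<^sup>2 + 1) * (1 - cos s)) + 1 * ((real N)^3 * (1 - cos s))"
    unfolding abs_mult
  proof (intro add_mono mult_mono)
    show "\<bar>cos (real N * s) - cos s\<bar> \<le> ((real N)\<^sup>2 + 1) * (1 - cos s)"
    proof -
      have aux: "\<bar>x - y\<bar> \<le> X + (1 - y)" if "0 \<le> X" "1 - x \<le> X" "x \<le> 1" "y \<le> 1" for x y X :: real
        using that by linarith
      show ?thesis
        using aux[of "(real N)\<^sup>2 * (1 - cos s)" "cos (real N * s)" "cos s"] one_minus_cos_nat_mult_le[of N s]
        by (simp add: distrib_right)
    qed
  qed (auto simp: c_def d_def sin_nat_mult_diff_le)
  finally have "e * \<bar>c * (cos (real N * s) - cos s) - d * (sin (real N * s) - real N * sin s)\<bar>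
      \<le> e * ((real N ^ 3 + real N ^ 2 + 1) * (1 - cos s))"
    using e_pos by (intro mult_left_mono) (auto simp: algebra_simps)
  also have "\<dots> \<le> 1/2 * (1 - cos s)"
    unfolding mult.assoc[symmetric] using e_small cs by (intro mult_right_mono)
  finally have "\<bar>e * (c * (cos (real N * s) - cos s) - d * (sin (real N * s) - real N * sin s))\<bar> \<le> 1/2 * (1 - cos s)"
    using e_pos by (simp add: abs_mult)
  moreover have aux: "x \<le> 2 * (x - y)" if "\<bar>y\<bar> \<le> 1/2 * x" for x y :: real
    using that by (auto simp: abs_le_iff)
  ultimately have "1 - cos s \<le> 2 * nb \<phi> \<psi>" unfolding nb by blast
  moreover have "cos s = cos (\<psi> - \<phi>)" unfolding s_def by (metis cos_minus minus_diff_eq)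
  ultimately show ?thesis by simp
qed

lemma nb_pos: "cos (\<psi> - \<phi>) < 1 \<Longrightarrow> 0 < nb \<phi> \<psi>"
  using nb_lower[of \<psi> \<phi>] by linarith

lemma nb_nonneg: "0 \<le> nb \<phi> \<psi>"
  using nb_lower[of \<psi> \<phi>] cos_le_one[of "\<psi> - \<phi>"] by linarith

text \<open>The normal component at the other end of the chord is obtained by turning the frame
  through \<open>\<psi> - \<phi>\<close>. Its positivity is what controls both the sign of
  \<open>Q2\<close> and the comparison of \<open>Q\<close> with the cotangent.\<close>

lemma nb_swap: "nb \<psi> \<phi> = ta \<phi> \<psi> * sin (\<psi> - \<phi>) - nb \<phi> \<psi> * cos (\<psi> - \<phi>)"
proof -
  define s where "s = \<psi> - \<phi>"
  have s: "cos (\<phi> - \<psi>) = cos s" "sin (\<phi> - \<psi>) = - sin s"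
    unfolding s_def by (metis cos_minus minus_diff_eq, metis sin_minus minus_diff_eq)
  have "(sin s)\<^sup>2 + (cos s)\<^sup>2 = 1" by simp
  then show ?thesis
    unfolding ta_def nb_def s s_def[symmetric] by algebra
qed

lemma Gam_diff:
  "fst (Gam \<psi> - Gam \<phi>) = - nb \<phi> \<psi> * cos \<phi> - ta \<phi> \<psi> * sin \<phi>"
  "snd (Gam \<psi> - Gam \<phi>) = - nb \<phi> \<psi> * sin \<phi> + ta \<phi> \<psi> * cos \<phi>"
proof -
  have "cos \<psi> = cos (\<psi> - \<phi>) * cos \<phi> - sin (\<psi> - \<phi>) * sin \<phi>" "sin \<psi> = sin (\<psi> - \<phi>) * cos \<phi> + cos (\<psi> - \<phi>) * sin \<phi>"
    by (simp_all flip: cos_add sin_add)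
  moreover define c d where "c = cos (\<psi> - \<phi>)" and "d = sin (\<psi> - \<phi>)"
  ultimately have e: "cos \<psi> = c * cos \<phi> - d * sin \<phi>" "sin \<psi> = d * cos \<phi> + c * sin \<phi>" by simp_all
  have f: "(sin \<phi>)\<^sup>2 + (cos \<phi>)\<^sup>2 = 1" by simp
  show "fst (Gam \<psi> - Gam \<phi>) = - nb \<phi> \<psi> * cos \<phi> - ta \<phi> \<psi> * sin \<phi>"
    unfolding Gam_def nb_def ta_def e fst_diff fst_conv \<open>c = _\<close>[symmetric] \<open>d = _\<close>[symmetric] by (simp add: algebra_simps)
  show "snd (Gam \<psi> - Gam \<phi>) = - nb \<phi> \<psi> * sin \<phi> + ta \<phi> \<psi> * cos \<phi>"
    unfolding Gam_def nb_def ta_def e snd_diff snd_conv \<open>c = _\<close>[symmetric] \<open>d = _\<close>[symmetric] by (simp add: algebra_simps)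
qed

lemma Gam_diff_tangent: "inner (Gam \<psi> - Gam \<phi>) (- sin \<phi>, cos \<phi>) = ta \<phi> \<psi>"
proof -
  have f: "(sin \<phi>)\<^sup>2 + (cos \<phi>)\<^sup>2 = 1" by simp
  show ?thesis unfolding inner_prod_def Gam_diff fst_conv snd_conv inner_real_def using f by algebra
qed

lemma Gam_diff_normal: "inner (Gam \<psi> - Gam \<phi>) (cos \<phi>, sin \<phi>) = - nb \<phi> \<psi>"
proof -
  have f: "(sin \<phi>)\<^sup>2 + (cos \<phi>)\<^sup>2 = 1" by simp
  show ?thesis unfolding inner_prod_def Gam_diff fst_conv snd_conv inner_real_def using f by algebra
qed

lemma norm_Gam_diff: "norm (Gam \<psi> - Gam \<phi>) = sqrt ((ta \<phi> \<psi>)\<^sup>2 + (nb \<phi> \<psi>)\<^sup>2)"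
proof -
  have f: "(sin \<phi>)\<^sup>2 + (cos \<phi>)\<^sup>2 = 1" by simp
  have "norm (Gam \<psi> - Gam \<phi>) = sqrt ((fst (Gam \<psi> - Gam \<phi>))\<^sup>2 + (snd (Gam \<psi> - Gam \<phi>))\<^sup>2)"
    by (metis norm_Pair prod.collapse real_norm_def power2_abs)
  also have "(fst (Gam \<psi> - Gam \<phi>))\<^sup>2 + (snd (Gam \<psi> - Gam \<phi>))\<^sup>2 = (ta \<phi> \<psi>)\<^sup>2 + (nb \<phi> \<psi>)\<^sup>2"
    unfolding Gam_diff using f by algebra
  finally show ?thesis .
qed

text \<open>\<open>Q\<close> is the cotangent of the angle between the chord and the tangent, so the law of reflection
  at \<open>\<phi>\<close> only compares values of \<open>Q \<phi>\<close>.\<close>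

lemma reflection_of_Q:
  assumes "cos (\<psi> - \<phi>) < 1" "cos (\<psi>' - \<phi>) < 1" "Q \<phi> \<psi>' = - Q \<phi> \<psi>"
  shows "inner (sgn (Gam \<phi> - Gam \<psi>)) (c *\<^sub>R (- sin \<phi>, cos \<phi>)) =
         inner (sgn (Gam \<psi>' - Gam \<phi>)) (c *\<^sub>R (- sin \<phi>, cos \<phi>))"
proof -
  \<comment> \<open>The cosine of the angle to the tangent is an odd function of \<open>Q\<close>;
    the sign is absorbed by the opposite orientation of the incoming chord.\<close>
  have *: "inner (sgn (Gam \<psi> - Gam \<phi>)) (- sin \<phi>, cos \<phi>) = Q \<phi> \<psi> / sqrt ((Q \<phi> \<psi>)\<^sup>2 + 1)"
    if "cos (\<psi> - \<phi>) < 1" for \<psi>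
  proof -
    have p: "0 < nb \<phi> \<psi>" using that by (rule nb_pos)
    have "(ta \<phi> \<psi>)\<^sup>2 + (nb \<phi> \<psi>)\<^sup>2 = ((Q \<phi> \<psi>)\<^sup>2 + 1) * (nb \<phi> \<psi>)\<^sup>2"
      using p by (simp add: Q_def field_simps)
    then have "sqrt ((ta \<phi> \<psi>)\<^sup>2 + (nb \<phi> \<psi>)\<^sup>2) = sqrt ((Q \<phi> \<psi>)\<^sup>2 + 1) * nb \<phi> \<psi>"
      using p by (simp add: real_sqrt_mult)
    moreover have "ta \<phi> \<psi> = Q \<phi> \<psi> * nb \<phi> \<psi>" using p by (simp add: Q_def)
    ultimately show ?thesis
      using p unfolding sgn_div_norm inner_scaleR_left Gam_diff_tangent norm_Gam_diff
      by (simp add: divide_inverse)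
  qed
  have "sgn (Gam \<phi> - Gam \<psi>) = - sgn (Gam \<psi> - Gam \<phi>)"
    by (metis minus_diff_eq sgn_minus)
  then show ?thesis
    unfolding inner_scaleR_right using * [OF assms(1)] * [OF assms(2)] assms(3) by simp
qed

lemma Gam_has_vector_derivative:
  "(Gam has_vector_derivative (R \<phi> *\<^sub>R (- sin \<phi>, cos \<phi>))) (at \<phi>)"
proof -
  have "((\<lambda>\<phi>. h \<phi> * cos \<phi> - h' \<phi> * sin \<phi>) has_field_derivative (- R \<phi> * sin \<phi>)) (at \<phi>)"
    by (auto intro!: derivative_eq_intros simp: algebra_simps)
  moreover have "((\<lambda>\<phi>. h \<phi> * sin \<phi> + h' \<phi> * cos \<phi>) has_field_derivative (R \<phi> * cos \<phi>)) (at \<phi>)"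
    by (auto intro!: derivative_eq_intros simp: algebra_simps)
  ultimately show ?thesis
    unfolding Gam_def[abs_def]
    by (auto intro!: has_vector_derivative_Pair simp: has_real_derivative_iff_has_vector_derivative)
qed

section \<open>Rotational and mirror symmetries of the curve\<close>

lemma h_shift: "h (\<phi> + 2 * pi * of_int k / real N) = h \<phi>"
  and h'_shift: "h' (\<phi> + 2 * pi * of_int k / real N) = h' \<phi>"
  and R_shift: "R (\<phi> + 2 * pi * of_int k / real N) = R \<phi>"
proof -
  have "real N * (\<phi> + 2 * pi * of_int k / real N) = real N * \<phi> + 2 * pi * of_int k"
    using N_ge by (simp add: field_simps)
  then show "h (\<phi> + 2 * pi * of_int k / real N) = h \<phi>" "h' (\<phi> + 2 * pi * of_int k / real N) = h' \<phi>"
    "R (\<phi> + 2 * pi * of_int k / real N) = R \<phi>"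
    unfolding h_def h'_def R_def by (simp_all add: cos_add_2pi_int sin_add_2pi_int)
qed

lemma h_period: "h (\<phi> + 2 * pi * of_int k) = h \<phi>" "h' (\<phi> + 2 * pi * of_int k) = h' \<phi>" "R (\<phi> + 2 * pi * of_int k) = R \<phi>"
proof -
  have "2 * pi * of_int (k * int N) / real N = 2 * pi * of_int k" using N_ge by simp
  then show "h (\<phi> + 2 * pi * of_int k) = h \<phi>" "h' (\<phi> + 2 * pi * of_int k) = h' \<phi>" "R (\<phi> + 2 * pi * of_int k) = R \<phi>"
    using h_shift[of \<phi> "k * int N"] h'_shift[of \<phi> "k * int N"] R_shift[of \<phi> "k * int N"] by simp_all
qed

lemma Gam_period: "Gam (\<phi> + 2 * pi * of_int k) = Gam \<phi>"
  by (simp add: Gam_def h_period cos_add_2pi_int sin_add_2pi_int)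

lemma Q_shift: "Q (\<phi> + 2 * pi * of_int k / real N) (\<psi> + 2 * pi * of_int k / real N) = Q \<phi> \<psi>"
  unfolding Q_def ta_def nb_def h_shift h'_shift by simp

lemma Q_period: "Q \<phi> (\<psi> + 2 * pi) = Q \<phi> \<psi>"
proof -
  have "sin (\<psi> + 2 * pi - \<phi>) = sin (\<psi> - \<phi>)" "cos (\<psi> + 2 * pi - \<phi>) = cos (\<psi> - \<phi>)"
    using sin_periodic[of "\<psi> - \<phi>"] cos_periodic[of "\<psi> - \<phi>"] by (simp_all add: algebra_simps)
  then show ?thesis
    using h_period[of \<psi> 1] unfolding Q_def ta_def nb_def by simp
qed

lemma Q_minus: "Q (- \<phi>) (- \<psi>) = - Q \<phi> \<psi>"
proof -
  have "sin (- \<psi> + \<phi>) = - sin (\<psi> - \<phi>)" "cos (- \<psi> + \<phi>) = cos (\<psi> - \<phi>)"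
    by (metis sin_minus minus_diff_eq diff_conv_add_uminus add.commute,
        metis cos_minus minus_diff_eq diff_conv_add_uminus add.commute)
  then show ?thesis unfolding Q_def ta_def nb_def h_def h'_def by (simp add: divide_simps)
qed

section \<open>The billiard map\<close>

text \<open>\<open>Q1\<close> and \<open>Q2\<close> are the partial derivatives of \<open>Q\<close>
  in its first and second argument; the numerator of \<open>Q2\<close> is simplified by
  \<open>nb_swap\<close>.\<close>

definition Q1 :: "real \<Rightarrow> real \<Rightarrow> real" where
  "Q1 \<phi> \<psi> = ((nb \<phi> \<psi>)\<^sup>2 - R \<phi> * nb \<phi> \<psi> + (ta \<phi> \<psi>)\<^sup>2) / (nb \<phi> \<psi>)\<^sup>2"
definition Q2 :: "real \<Rightarrow> real \<Rightarrow> real" where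
  "Q2 \<phi> \<psi> = - R \<psi> * nb \<psi> \<phi> / (nb \<phi> \<psi>)\<^sup>2"

lemma has_derivative_h:
  assumes "(f has_derivative f') (at x)"
  shows "((\<lambda>x. h (f x)) has_derivative (\<lambda>d. f' d * h' (f x))) (at x)"
  using DERIV_compose_FDERIV[OF _ assms, of h "h' (f x)"] DERIV_h[OF DERIV_ident, of "f x" UNIV] by simp

lemma has_derivative_h':
  assumes "(f has_derivative f') (at x)"
  shows "((\<lambda>x. h' (f x)) has_derivative (\<lambda>d. f' d * (R (f x) - h (f x)))) (at x)"
  using DERIV_compose_FDERIV[OF _ assms, of h' "R (f x) - h (f x)"] DERIV_h'[OF DERIV_ident, of "f x" UNIV] by simp

lemma ta_has_derivative:
  "((\<lambda>p. ta (fst p) (snd p)) has_derivative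
    (\<lambda>d. (nb \<phi> \<psi> - R \<phi>) * fst d + R \<psi> * cos (\<psi> - \<phi>) * snd d)) (at (\<phi>, \<psi>))"
  unfolding ta_def
  by (rule derivative_eq_intros has_derivative_h has_derivative_h' refl)+
    (simp add: nb_def algebra_simps fun_eq_iff)

lemma nb_has_derivative:
  "((\<lambda>p. nb (fst p) (snd p)) has_derivative
    (\<lambda>d. - ta \<phi> \<psi> * fst d + R \<psi> * sin (\<psi> - \<phi>) * snd d)) (at (\<phi>, \<psi>))"
  unfolding nb_def
  by (rule derivative_eq_intros has_derivative_h has_derivative_h' refl)+
    (simp add: ta_def algebra_simps fun_eq_iff)

lemma Q_has_derivative:
  assumes "cos (\<psi> - \<phi>) < 1"
  shows "((\<lambda>p. Q (fst p) (snd p)) has_derivative (\<lambda>d. Q1 \<phi> \<psi> * fst d + Q2 \<phi> \<psi> * snd d)) (at (\<phi>, \<psi>))"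
proof -
  have p: "0 < nb \<phi> \<psi>" using assms by (rule nb_pos)
  have *: "((nb \<phi> \<psi> - R \<phi>) * a + R \<psi> * cos (\<psi> - \<phi>) * b) * nb \<phi> \<psi> - ta \<phi> \<psi> * (- ta \<phi> \<psi> * a + R \<psi> * sin (\<psi> - \<phi>) * b)
     = ((nb \<phi> \<psi>)\<^sup>2 - R \<phi> * nb \<phi> \<psi> + (ta \<phi> \<psi>)\<^sup>2) * a + (- R \<psi> * nb \<psi> \<phi>) * b" for a b
    unfolding nb_swap[of \<psi> \<phi>] by (simp add: algebra_simps power2_eq_square)
  have "Q1 \<phi> \<psi> * a + Q2 \<phi> \<psi> * b = (((nb \<phi> \<psi> - R \<phi>) * a + R \<psi> * cos (\<psi> - \<phi>) * b) * nb \<phi> \<psi> -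
      ta \<phi> \<psi> * (- ta \<phi> \<psi> * a + R \<psi> * sin (\<psi> - \<phi>) * b)) / (nb \<phi> \<psi> * nb \<phi> \<psi>)" for a b
    unfolding * by (simp only: Q1_def Q2_def power2_eq_square times_divide_eq_left flip: add_divide_distrib)
  with has_derivative_divide'[OF ta_has_derivative nb_has_derivative, of \<phi> \<psi>] p
  show ?thesis unfolding Q_def by simp
qed

text \<open>This is the twist property of the billiard map: \<open>nb\<close> is positive at both
  ends of a chord and the radius of curvature is positive.\<close>

lemma Q2_neg: "cos (\<psi> - \<phi>) < 1 \<Longrightarrow> Q2 \<phi> \<psi> < 0"
  using nb_pos[of \<psi> \<phi>] nb_pos[of \<phi> \<psi>] R_pos[of \<psi>] cos_minus[of "\<psi> - \<phi>"]
  unfolding Q2_def by (simp add: divide_neg_pos)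

lemma tendsto_Q:
  assumes "(f \<longlongrightarrow> \<phi>) F" "(g \<longlongrightarrow> \<psi>) F" "cos (\<psi> - \<phi>) < 1"
  shows "((\<lambda>x. Q (f x) (g x)) \<longlongrightarrow> Q \<phi> \<psi>) F"
proof -
  have "isCont (\<lambda>p. Q (fst p) (snd p)) (\<phi>, \<psi>)"
    using Q_has_derivative[OF assms(3)] by (rule has_derivative_continuous)
  from isCont_tendsto_compose[OF this tendsto_Pair[OF assms(1,2)]] show ?thesis by simp
qed

lemma DERIV_Q:
  assumes "cos (\<psi> - \<phi>) < 1"
  shows "(Q \<phi> has_real_derivative Q2 \<phi> \<psi>) (at \<psi>)"
proof -
  have "((\<lambda>\<psi>. (\<phi>, \<psi>)) has_derivative (\<lambda>d. (0, d))) (at \<psi>)"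
    by (auto intro!: derivative_eq_intros)
  from has_derivative_compose[OF this Q_has_derivative[OF assms]]
  show ?thesis by (simp add: has_field_derivative_def)
qed

section \<open>Existence, uniqueness and smoothness of the next impact\<close>

lemma cos_less_one_between: "\<phi> < \<psi> \<Longrightarrow> \<psi> < \<phi> + 2 * pi \<Longrightarrow> cos (\<psi> - \<phi>) < 1"
  by (rule cos_less_one) auto

lemma Q_strict_antimono:
  assumes "\<phi> < \<psi>" "\<psi> < \<psi>'" "\<psi>' < \<phi> + 2 * pi"
  shows "Q \<phi> \<psi>' < Q \<phi> \<psi>"
  using \<open>\<psi> < \<psi>'\<close>
proof (rule DERIV_neg_imp_decreasing)
  fix x assume "\<psi> \<le> x" "x \<le> \<psi>'"
  then have "cos (x - \<phi>) < 1" using assms by (intro cos_less_one_between) auto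
  then show "\<exists>y. (Q \<phi> has_real_derivative y) (at x) \<and> y < 0"
    using DERIV_Q Q2_neg by blast
qed

lemma Q_antimono:
  assumes "\<phi> < \<psi>" "\<psi> \<le> \<psi>'" "\<psi>' < \<phi> + 2 * pi"
  shows "Q \<phi> \<psi>' \<le> Q \<phi> \<psi>"
  using Q_strict_antimono[of \<phi> \<psi> \<psi>'] assms by (cases "\<psi> = \<psi>'") auto

lemma Q_inj:
  assumes "\<phi> < \<psi>" "\<psi> < \<phi> + 2 * pi" "\<phi> < \<psi>'" "\<psi>' < \<phi> + 2 * pi" "Q \<phi> \<psi> = Q \<phi> \<psi>'"
  shows "\<psi> = \<psi>'"
  using Q_strict_antimono[of \<phi> \<psi> \<psi>'] Q_strict_antimono[of \<phi> \<psi>' \<psi>] assms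
  by (metis less_irrefl linorder_less_linear)

text \<open>By \<open>nb_swap\<close>, positivity of \<open>nb\<close> at the far end means that
  \<open>nb * cos s\<close> is below \<open>ta * sin s\<close>; dividing by
  \<open>nb * sin s\<close> gives the claim. The bound does not depend on \<phi>.\<close>

lemma Q_gt_cot:
  assumes "0 < s" "s < pi"
  shows "cot s < Q \<phi> (\<phi> + s)"
proof -
  have "cos s < 1" using assms by (intro cos_less_one) auto
  then have p: "0 < nb \<phi> (\<phi> + s)" "0 < nb (\<phi> + s) \<phi>" by (auto intro: nb_pos)
  have "0 < sin s" using assms by (rule sin_gt_zero)
  with p show ?thesis
    unfolding nb_swap[of "\<phi> + s" \<phi>] cot_def Q_def by (simp add: field_simps)
qed

lemma Q_less_cot:
  assumes "pi < s" "s < 2 * pi"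
  shows "Q \<phi> (\<phi> + s) < cot s"
proof -
  have "cos s < 1" using assms by (intro cos_less_one) auto
  then have p: "0 < nb \<phi> (\<phi> + s)" "0 < nb (\<phi> + s) \<phi>" by (auto intro: nb_pos)
  have "sin s < 0" using assms by (rule sin_lt_zero)
  with p show ?thesis
    unfolding nb_swap[of "\<phi> + s" \<phi>] cot_def Q_def by (simp add: field_simps)
qed

text \<open>If \<open>cot s = q\<close>, then also \<open>cot (s + pi) = q\<close>, and the
  cotangent bounds place \<open>q\<close> between the values of \<open>Q \<phi>\<close> at
  \<open>\<phi> + s + pi\<close> and \<open>\<phi> + s\<close>.\<close>

lemma Q_surj: "\<exists>\<psi>. \<phi> < \<psi> \<and> \<psi> < \<phi> + 2 * pi \<and> Q \<phi> \<psi> = q"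
proof -
  define s where "s = pi / 2 - arctan q"
  have s: "0 < s" "s < pi" using arctan_bounded[of q] by (auto simp: s_def)
  have c: "cot s = q"
    using tan_arctan[of q] by (simp add: s_def cot_def cos_diff sin_diff tan_def)
  have "sin s \<noteq> 0" using sin_gt_zero[OF s] by simp
  then have "cot (s + pi) = q" using c by (simp add: cot_def)
  then have "Q \<phi> (\<phi> + (s + pi)) < q" using Q_less_cot[of "s + pi" \<phi>] s by simp
  moreover have "q < Q \<phi> (\<phi> + s)" using Q_gt_cot[OF s] c by simp
  ultimately have "\<exists>\<psi>\<ge>\<phi> + s. \<psi> \<le> \<phi> + (s + pi) \<and> Q \<phi> \<psi> = q"
  proof (intro IVT2)
    show "\<forall>x. \<phi> + s \<le> x \<and> x \<le> \<phi> + (s + pi) \<longrightarrow> isCont (Q \<phi>) x"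
    proof (intro allI impI)
      fix x assume "\<phi> + s \<le> x \<and> x \<le> \<phi> + (s + pi)"
      then have "cos (x - \<phi>) < 1" using s by (intro cos_less_one_between) auto
      then show "isCont (Q \<phi>) x" using DERIV_Q DERIV_isCont by blast
    qed
  qed auto
  then show ?thesis using s by force
qed

text \<open>\<open>S\<close> gives the angle of the next impact for a ball leaving \<phi> along the
  chord with cotangent \<open>q\<close>. The description is meaningful by \<open>Q_surj\<close> and
  \<open>Q_inj\<close>.\<close>

definition S :: "real \<Rightarrow> real \<Rightarrow> real" where
  "S \<phi> q = (THE \<psi>. \<phi> < \<psi> \<and> \<psi> < \<phi> + 2 * pi \<and> Q \<phi> \<psi> = q)"

lemma S_eqI: "\<phi> < \<psi> \<Longrightarrow> \<psi> < \<phi> + 2 * pi \<Longrightarrow> Q \<phi> \<psi> = q \<Longrightarrow> S \<phi> q = \<psi>"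
  unfolding S_def using Q_inj by (intro the_equality) auto

lemma S: "\<phi> < S \<phi> q" "S \<phi> q < \<phi> + 2 * pi" "Q \<phi> (S \<phi> q) = q"
proof -
  obtain \<psi> where "\<phi> < \<psi>" "\<psi> < \<phi> + 2 * pi" "Q \<phi> \<psi> = q"
    using Q_surj by blast
  then show "\<phi> < S \<phi> q" "S \<phi> q < \<phi> + 2 * pi" "Q \<phi> (S \<phi> q) = q"
    using S_eqI by simp_all
qed

text \<open>At a fixed \<open>b\<close> strictly between the bound \<open>a\<close> and the limit,
  the sign of \<open>Q \<phi> b - q\<close> persists under small changes of \<phi> and
  \<open>q\<close>; monotonicity of \<open>Q\<close> then keeps the root on its side of
  \<open>b\<close>.\<close>

lemma tendsto_S:
  assumes f: "(f \<longlongrightarrow> \<phi>) F" and g: "(g \<longlongrightarrow> q) F"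
  shows "((\<lambda>x. S (f x) (g x)) \<longlongrightarrow> S \<phi> q) F"
proof (rule order_tendstoI)
  fix a assume a: "a < S \<phi> q"
  \<comment> \<open>The maximum with \<phi> keeps \<open>b\<close> inside the interval on which
    \<open>Q \<phi>\<close> is monotone.\<close>
  define b where "b = (max a \<phi> + S \<phi> q) / 2"
  have b: "a < b" "\<phi> < b" "b < S \<phi> q" using a S(1)[of \<phi> q] by (auto simp: b_def)
  have "q < Q \<phi> b" using Q_strict_antimono[of \<phi> b "S \<phi> q"] b S(2,3)[of \<phi> q] by simp
  moreover have "((\<lambda>x. Q (f x) b - g x) \<longlongrightarrow> Q \<phi> b - q) F"
    using b S(2)[of \<phi> q] by (intro tendsto_diff tendsto_Q f g tendsto_const cos_less_one_between) auto
  ultimately have "\<forall>\<^sub>F x in F. 0 < Q (f x) b - g x" by (intro order_tendstoD(1)) auto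
  moreover have "\<forall>\<^sub>F x in F. b - 2 * pi < f x" "\<forall>\<^sub>F x in F. f x < b"
    using b S(2)[of \<phi> q] f by (auto intro: order_tendstoD)
  ultimately show "\<forall>\<^sub>F x in F. a < S (f x) (g x)"
  proof eventually_elim
    case (elim x)
    have "\<not> S (f x) (g x) \<le> b"
      using Q_antimono[of "f x" "S (f x) (g x)" b] S[of "f x" "g x"] elim by auto
    with b show ?case by simp
  qed
next
  fix a assume a: "S \<phi> q < a"
  define b where "b = (min a (\<phi> + 2 * pi) + S \<phi> q) / 2"
  have b: "b < a" "b < \<phi> + 2 * pi" "S \<phi> q < b" using a S(2)[of \<phi> q] by (auto simp: b_def)
  have "Q \<phi> b < q" using Q_strict_antimono[of \<phi> "S \<phi> q" b] b S(1,3)[of \<phi> q] by simp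
  moreover have "((\<lambda>x. Q (f x) b - g x) \<longlongrightarrow> Q \<phi> b - q) F"
    using b S(1)[of \<phi> q] by (intro tendsto_diff tendsto_Q f g tendsto_const cos_less_one_between) auto
  ultimately have "\<forall>\<^sub>F x in F. Q (f x) b - g x < 0" by (intro order_tendstoD(2)) auto
  moreover have "\<forall>\<^sub>F x in F. b - 2 * pi < f x" "\<forall>\<^sub>F x in F. f x < b"
    using b S(1)[of \<phi> q] f by (auto intro: order_tendstoD)
  ultimately show "\<forall>\<^sub>F x in F. S (f x) (g x) < a"
  proof eventually_elim
    case (elim x)
    have "\<not> b \<le> S (f x) (g x)"
      using Q_antimono[of "f x" b "S (f x) (g x)"] S[of "f x" "g x"] elim by auto
    with b show ?case by simp
  qed
qed

text \<open>The map \<open>(\<phi>, q)\<close> to \<open>(\<phi>, S \<phi> q)\<close> inverts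
  \<open>(\<phi>, \<psi>)\<close> to \<open>(\<phi>, Q \<phi> \<psi>)\<close>, whose derivative is
  triangular with nonzero diagonal entry \<open>Q2\<close>; continuity of the inverse is
  \<open>tendsto_S\<close>.\<close>

lemma S_has_derivative:
  assumes "cos (S \<phi> q - \<phi>) < 1"
  shows "((\<lambda>p. S (fst p) (snd p)) has_derivative
     (\<lambda>d. (snd d - Q1 \<phi> (S \<phi> q) * fst d) / Q2 \<phi> (S \<phi> q))) (at (\<phi>, q))"
proof -
  define A where "A = Q1 \<phi> (S \<phi> q)"
  define B where "B = Q2 \<phi> (S \<phi> q)"
  have B: "B \<noteq> 0" using Q2_neg[OF assms] by (simp add: B_def)
  let ?g = "\<lambda>p. (fst p, S (fst p) (snd p))"
  let ?g' = "\<lambda>d::real\<times>real. (fst d, (snd d - A * fst d) / B)"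
  have lin: "bounded_linear ?g'"
    unfolding divide_inverse
    by (intro bounded_linear_Pair bounded_linear_fst bounded_linear_snd bounded_linear_sub
        bounded_linear_mult_const bounded_linear_const_mult)
  have "(?g has_derivative ?g') (at (\<phi>, q))"
  proof (rule has_derivative_inverse_basic[where f = "\<lambda>p. (fst p, Q (fst p) (snd p))" and T = UNIV])
    show "((\<lambda>p. (fst p, Q (fst p) (snd p))) has_derivative (\<lambda>d. (fst d, A * fst d + B * snd d)))
       (at (fst (\<phi>, q), S (fst (\<phi>, q)) (snd (\<phi>, q))))"
      unfolding A_def B_def
      by (auto intro!: derivative_eq_intros Q_has_derivative assms)
    show "bounded_linear ?g'" by (rule lin)
    show "?g' \<circ> (\<lambda>d. (fst d, A * fst d + B * snd d)) = id"
      using B by (auto simp: fun_eq_iff)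
    have "((\<lambda>p. S (fst p) (snd p)) \<longlongrightarrow> S \<phi> q) (at (\<phi>, q))"
      by (rule tendsto_S) (auto intro!: tendsto_eq_intros)
    then show "continuous (at (\<phi>, q)) ?g"
      by (auto simp: continuous_at intro!: tendsto_eq_intros)
  qed (auto simp: S)
  from has_derivative_snd[OF this] show ?thesis by (simp add: A_def B_def)
qed

section \<open>Symmetric orbits\<close>

definition tau :: real where "tau = 2 * pi * of_int m / real N"

lemma tau: "0 < tau" "tau < 2 * pi" "cos tau < 1"
proof -
  show "0 < tau" using m_pos N_ge by (simp add: tau_def)
  have "real_of_int m < real N" using m_less by (metis of_int_less_iff of_int_of_nat_eq)
  then show "tau < 2 * pi" using N_ge by (simp add: tau_def field_simps)
  with \<open>0 < tau\<close> show "cos tau < 1" by (rule cos_less_one)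
qed

lemma int_mult_tau: "of_int k * tau = 2 * pi * of_int (k * m) / real N"
  by (simp add: tau_def)

lemma Q_shift_tau: "Q (\<phi> + of_int k * tau) (\<psi> + of_int k * tau) = Q \<phi> \<psi>"
  unfolding int_mult_tau by (rule Q_shift)

text \<open>The mirror symmetry combined with a rotation is the reflection in the axis at angle
  \<open>k * tau / 2\<close>.\<close>

lemma Q_reflect: "Q (of_int k * tau - \<phi>) (of_int k * tau - \<psi>) = - Q \<phi> \<psi>"
  using Q_shift_tau[of "- \<phi>" k "- \<psi>"] by (simp add: Q_minus)

text \<open>Normal angles of the orbit that starts on the symmetry axis at angle 0 and first hits
  the curve at angle \<open>t\<close>.\<close>

fun orb :: "real \<Rightarrow> nat \<Rightarrow> real" where
  "orb t 0 = 0"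
| "orb t (Suc 0) = t"
| "orb t (Suc (Suc i)) = S (orb t (Suc i)) (- Q (orb t (Suc i)) (orb t i))"

lemma orb_step:
  assumes "0 < t" "t < 2 * pi"
  shows "orb t i < orb t (Suc i)" "orb t (Suc i) < orb t i + 2 * pi"
  using assms S by (cases i; simp)+

lemma orb_law:
  "Q (orb t (Suc i)) (orb t (Suc (Suc i))) = - Q (orb t (Suc i)) (orb t i)"
  by (simp add: S)

lemma cos_less_one_swap: "cos (\<psi> - \<phi>) < 1 \<Longrightarrow> cos (\<phi> - \<psi>) < (1::real)"
  using cos_minus[of "\<psi> - \<phi>"] by simp

lemma orb_tau: "orb tau i = real i * tau"
proof (induction i rule: induct_nat_012)
  case (ge2 i)
  let ?k = "int i + 1"
  have "Q (of_int ?k * tau) (real (Suc (Suc i)) * tau) = Q 0 tau"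
    using Q_shift_tau[of 0 ?k tau] by (simp add: algebra_simps)
  moreover have "Q (of_int ?k * tau) (real i * tau) = Q 0 (- tau)"
    using Q_shift_tau[of 0 ?k "- tau"] by (simp add: algebra_simps)
  ultimately have "Q (real (Suc i) * tau) (real (Suc (Suc i)) * tau) = - Q (real (Suc i) * tau) (real i * tau)"
    using Q_minus[of 0 tau] by (simp add: add.commute)
  then have "S (real (Suc i) * tau) (- Q (real (Suc i) * tau) (real i * tau)) = real (Suc (Suc i)) * tau"
    using tau by (intro S_eqI) (auto simp: algebra_simps)
  with ge2 show ?case by simp
qed auto

lemma isCont_orb:
  assumes "0 < t" "t < 2 * pi"
  shows "isCont (\<lambda>t. orb t i) t"
proof (induction i rule: induct_nat_012)
  case (ge2 i)
  have "cos (orb t i - orb t (Suc i)) < 1"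
    using orb_step[OF assms, of i] by (intro cos_less_one_swap[OF cos_less_one_between])
  with ge2 show ?case
    unfolding orb.simps isCont_def by (intro tendsto_S tendsto_minus tendsto_Q)
qed auto

lemma at_multiple_of_tau:
  "h (of_int k * tau) = 1 - e" "h' (of_int k * tau) = 0" "R (of_int k * tau) = 1 - e + (real N)\<^sup>2 * e"
  using h_shift[of 0 "k * m"] h'_shift[of 0 "k * m"] R_shift[of 0 "k * m"] unfolding int_mult_tau
  by (simp_all add: h_def h'_def R_def algebra_simps)

text \<open>All vertices of the star polygon are equivalent under the symmetries, so the partial
  derivatives are the same at each. The equation for \<theta> is chosen to make the ratio of
  \<open>Q1\<close> to \<open>Q2\<close> equal to \<open>- cos \<theta>\<close>.\<close>

lemma Q12_at_multiple_of_tau: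
  assumes \<theta>: "(1 + cos \<theta>) * (1 - e + (real N)\<^sup>2 * e) = 2 * (1 - e)"
    and "l = k + 1 \<or> l = k - 1"
  shows "Q2 (of_int k * tau) (of_int l * tau) = Q2 0 tau"
    and "Q1 (of_int k * tau) (of_int l * tau) = - cos \<theta> * Q2 0 tau"
proof -
  have 0: "h 0 = 1 - e" "h' 0 = 0" "R 0 = 1 - e + (real N)\<^sup>2 * e" "h tau = 1 - e" "h' tau = 0" "R tau = R 0"
    using at_multiple_of_tau[of 0] at_multiple_of_tau[of 1] by simp_all
  have "of_int l * tau - of_int k * tau = tau \<or> of_int l * tau - of_int k * tau = - tau"
    using assms(2) by (auto simp: algebra_simps)
  then have cs: "cos (of_int l * tau - of_int k * tau) = cos tau" "cos (of_int k * tau - of_int l * tau) = cos tau"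
      "(sin (of_int l * tau - of_int k * tau))\<^sup>2 = (sin tau)\<^sup>2"
    by (metis cos_minus minus_diff_eq, metis cos_minus minus_diff_eq, metis sin_minus power2_minus)
  define b where "b = (1 - e) * (1 - cos tau)"
  have b: "0 < b" unfolding b_def using e_half(2) tau(3) by simp
  have nb: "nb (of_int k * tau) (of_int l * tau) = b" "nb (of_int l * tau) (of_int k * tau) = b"
    "nb 0 tau = b" "nb tau 0 = b"
    unfolding nb_def at_multiple_of_tau cs 0 by (simp_all add: b_def algebra_simps)
  have ta: "(ta (of_int k * tau) (of_int l * tau))\<^sup>2 = ((1 - e) * sin tau)\<^sup>2"
    unfolding ta_def at_multiple_of_tau using cs by (simp add: power_mult_distrib)
  show "Q2 (of_int k * tau) (of_int l * tau) = Q2 0 tau"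
    unfolding Q2_def nb at_multiple_of_tau 0 ..
  have s: "(sin tau)\<^sup>2 + (cos tau)\<^sup>2 = 1" by simp
  \<comment> \<open>The squares combine to \<open>2 * (1 - e) * b\<close>, so the left side is
    \<open>(2 * (1 - e) - R 0) * b\<close>.\<close>
  have "b\<^sup>2 - R 0 * b + ((1 - e) * sin tau)\<^sup>2 = cos \<theta> * (R 0 * b)"
    using \<theta>[folded 0(3)] s unfolding b_def by algebra
  then show "Q1 (of_int k * tau) (of_int l * tau) = - cos \<theta> * Q2 0 tau"
    unfolding Q1_def Q2_def nb ta at_multiple_of_tau 0(6) 0(3)[symmetric] by simp
qed

text \<open>The linearised orbit equation along the regular star polygon has constant coefficients.\<close>

lemma orb_has_derivative:
  assumes \<theta>: "(1 + cos \<theta>) * (1 - e + (real N)\<^sup>2 * e) = 2 * (1 - e)" and "sin \<theta> \<noteq> 0"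
  shows "((\<lambda>t. orb t i) has_real_derivative sin (real i * \<theta>) / sin \<theta>) (at tau)"
proof (induction i rule: induct_nat_012)
  case 1
  show ?case using assms by simp
next
  case (ge2 i)
  let ?\<phi> = "of_int (int i + 1) * tau" and ?\<psi> = "of_int (int i) * tau" and ?\<chi> = "of_int (int i + 2) * tau"
  define \<beta> where "\<beta> = Q2 0 tau"
  have \<beta>: "\<beta> \<noteq> 0" using Q2_neg[of tau 0] tau by (simp add: \<beta>_def)
  define x0 where "x0 = sin (real i * \<theta>) / sin \<theta>"
  define x1 where "x1 = sin (real (Suc i) * \<theta>) / sin \<theta>"
  define q where "q t = - Q (orb t (Suc i)) (orb t i)" for t
  have val: "orb tau i = ?\<psi>" "orb tau (Suc i) = ?\<phi>" "S ?\<phi> (q tau) = ?\<chi>"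
    using orb_tau[of i] orb_tau[of "Suc i"] orb_tau[of "Suc (Suc i)"] by (simp_all add: q_def algebra_simps)
  have c: "cos (?\<psi> - ?\<phi>) < 1" "cos (?\<chi> - ?\<phi>) < 1"
    using tau by (simp_all add: algebra_simps)
  have ge2': "((\<lambda>t. orb t i) has_derivative (\<lambda>d. x0 * d)) (at tau)"
      "((\<lambda>t. orb t (Suc i)) has_derivative (\<lambda>d. x1 * d)) (at tau)"
    using ge2 by (simp_all only: has_field_derivative_def x0_def x1_def)
  have Qd: "((\<lambda>t. q t) has_derivative (\<lambda>d. - (- cos \<theta> * \<beta> * (x1 * d) + \<beta> * (x0 * d)))) (at tau)"
    unfolding q_def
    using has_derivative_minus[OF has_derivative_compose[OF has_derivative_Pair[OF ge2'(2,1)],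
        of "\<lambda>p. Q (fst p) (snd p)", unfolded val, OF Q_has_derivative[OF c(1)]]]
      Q12_at_multiple_of_tau[OF \<theta>, of "int i" "int i + 1"]
    by (simp add: \<beta>_def)
  have "((\<lambda>t. orb t (Suc (Suc i))) has_derivative
      (\<lambda>d. ((- (- cos \<theta> * \<beta> * (x1 * d) + \<beta> * (x0 * d))) - (- cos \<theta> * \<beta>) * (x1 * d)) / \<beta>)) (at tau)"
    using has_derivative_compose[OF has_derivative_Pair[OF ge2'(2) Qd],
        of "\<lambda>p. S (fst p) (snd p)", unfolded val, OF S_has_derivative[of ?\<phi> "q tau", unfolded val, OF c(2)]]
      Q12_at_multiple_of_tau[OF \<theta>, of "int i + 2" "int i + 1"]
    by (simp add: \<beta>_def q_def)
  \<comment> \<open>The common factor \<beta> cancels and leaves the recurrence of the sequence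
    \<open>sin (i * \<theta>)\<close>.\<close>
  moreover have "((- (- cos \<theta> * \<beta> * (x1 * d) + \<beta> * (x0 * d))) - (- cos \<theta> * \<beta>) * (x1 * d)) / \<beta> = (2 * cos \<theta> * x1 - x0) * d" for d
    using \<beta> by (simp add: field_simps)
  moreover have "2 * cos \<theta> * x1 - x0 = sin (real (Suc (Suc i)) * \<theta>) / sin \<theta>"
  proof -
    have "sin (real (Suc (Suc i)) * \<theta>) = sin (real (Suc i) * \<theta>) * cos \<theta> + cos (real (Suc i) * \<theta>) * sin \<theta>"
      using sin_add[of "real (Suc i) * \<theta>" \<theta>] by (simp add: algebra_simps)
    moreover have "sin (real i * \<theta>) = sin (real (Suc i) * \<theta>) * cos \<theta> - cos (real (Suc i) * \<theta>) * sin \<theta>"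
      using sin_diff[of "real (Suc i) * \<theta>" \<theta>] by (simp add: algebra_simps)
    ultimately show ?thesis
      using assms(2) by (simp add: x0_def x1_def field_simps)
  qed
  ultimately show ?case unfolding has_field_derivative_def by (simp only:)
qed simp

text \<open>A step of almost a full turn ends in a nearly tangential impact: seen from \<phi>, the
  previous point lies just ahead. Hence \<open>Q \<phi> (\<phi> - s)\<close> is very large, the
  outgoing value very negative, and the next step again almost a full turn, uniformly in
  \<phi>.\<close>

lemma S_near_full_turn:
  assumes "0 < \<sigma>" "\<sigma> < 2 * pi"
  shows "\<exists>\<sigma>' < 2 * pi. \<forall>\<phi> s. \<sigma>' < s \<longrightarrow> s < 2 * pi \<longrightarrow> \<sigma> < S \<phi> (- Q \<phi> (\<phi> - s)) - \<phi>"
proof -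
  \<comment> \<open>Here \<open>ta\<close> is at most 5/2 in absolute value and \<open>nb\<close> at
    least half of \<open>1 - cos \<sigma>\<close>, so \<open>- c\<close> bounds
    \<open>Q \<phi> (\<phi> + \<sigma>)\<close> from below; \<open>u\<close> is the angle with
    cotangent \<open>c\<close>.\<close>
  define c where "c = 5 / (1 - cos \<sigma>)"
  define u where "u = pi / 2 - arctan c"
  have u: "0 < u" "u < pi" using arctan_bounded[of c] by (auto simp: u_def)
  have cu: "cot u = c"
    using tan_arctan[of c] by (simp add: u_def cot_def cos_diff sin_diff tan_def)
  have c1: "cos \<sigma> < 1" using assms by (rule cos_less_one)
  have lower: "- c \<le> Q \<phi> (\<phi> + \<sigma>)" for \<phi>
  proof -
    have nb: "1 - cos \<sigma> \<le> 2 * nb \<phi> (\<phi> + \<sigma>)" using nb_lower[of "\<phi> + \<sigma>" \<phi>] by simp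
    have "\<bar>h (\<phi> + \<sigma>) * sin \<sigma>\<bar> \<le> 3/2 * 1" "\<bar>h' (\<phi> + \<sigma>) * cos \<sigma>\<bar> \<le> 1/2 * 1"
      unfolding abs_mult using h_bounds[of "\<phi> + \<sigma>"] h'_bound[of "\<phi> + \<sigma>"]
      by (intro mult_mono; simp)+
    moreover have "ta \<phi> (\<phi> + \<sigma>) = h (\<phi> + \<sigma>) * sin \<sigma> + h' (\<phi> + \<sigma>) * cos \<sigma> - h' \<phi>"
      by (simp add: ta_def)
    ultimately have "\<bar>ta \<phi> (\<phi> + \<sigma>)\<bar> \<le> 5/2"
      using h'_bound[of \<phi>] unfolding abs_le_iff by simp
    then have ta: "- 5 \<le> 2 * ta \<phi> (\<phi> + \<sigma>)" unfolding abs_le_iff by simp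
    have "1 - cos \<sigma> \<noteq> 0" using c1 by simp
    from nonzero_eq_divide_eq[OF this, of c 5] have "c * (1 - cos \<sigma>) = 5" using c_def by blast
    moreover have "0 < c" using c1 by (simp add: c_def)
    moreover from \<open>0 < c\<close> have "c * (1 - cos \<sigma>) \<le> c * (2 * nb \<phi> (\<phi> + \<sigma>))"
      using nb by (intro mult_left_mono) auto
    ultimately have "- c * nb \<phi> (\<phi> + \<sigma>) \<le> ta \<phi> (\<phi> + \<sigma>)" using ta by simp
    moreover have "0 < nb \<phi> (\<phi> + \<sigma>)" using nb_pos[of "\<phi> + \<sigma>" \<phi>] c1 by simp
    ultimately show ?thesis
      unfolding Q_def by (simp add: pos_le_divide_eq pos_le_minus_divide_eq)
  qed
  show ?thesis
  proof (intro exI[of _ "2 * pi - u"] conjI allI impI)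
    show "2 * pi - u < 2 * pi" using u by simp
  next
    fix \<phi> s assume s: "2 * pi - u < s" "s < 2 * pi"
    define q where "q = - Q \<phi> (\<phi> - s)"
    have "Q \<phi> (\<phi> + u) \<le> Q \<phi> (\<phi> - s + 2 * pi)"
      using s u by (intro Q_antimono) auto
    then have "c < - q" using Q_gt_cot[OF u, of \<phi>] by (simp add: q_def Q_period cu)
    moreover have "Q \<phi> (\<phi> + \<sigma>) \<le> q" if "S \<phi> q \<le> \<phi> + \<sigma>"
      using Q_antimono[of \<phi> "S \<phi> q" "\<phi> + \<sigma>"] that S[of \<phi> q] assms by simp
    ultimately show "\<sigma> < S \<phi> (- Q \<phi> (\<phi> - s)) - \<phi>"
      using lower[of \<phi>] unfolding q_def by force
  qed
qed

lemma orb_steps_near_full_turn: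
  assumes "0 < \<sigma>" "\<sigma> < 2 * pi"
  shows "\<forall>\<^sub>F t in at_left (2 * pi). \<sigma> < orb t (Suc i) - orb t i"
  using assms
proof (induction i arbitrary: \<sigma>)
  case 0
  then show ?case
    using eventually_at_left_real[of \<sigma> "2 * pi"] by (auto elim: eventually_mono)
next
  case (Suc i)
  obtain \<sigma>' where \<sigma>': "\<sigma>' < 2 * pi" "\<And>\<phi> s. \<sigma>' < s \<Longrightarrow> s < 2 * pi \<Longrightarrow> \<sigma> < S \<phi> (- Q \<phi> (\<phi> - s)) - \<phi>"
    using S_near_full_turn[OF Suc.prems] by blast
  \<comment> \<open>The induction hypothesis requires a positive bound, which is not known of
    \<open>\<sigma>'\<close> alone.\<close>
  have "\<forall>\<^sub>F t in at_left (2 * pi). max 1 \<sigma>' < orb t (Suc i) - orb t i"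
    using \<sigma>'(1) pi_gt3 by (intro Suc.IH) auto
  moreover have "\<forall>\<^sub>F t in at_left (2 * pi). t \<in> {0<..<2 * pi}"
    by (rule eventually_at_left_real) simp
  ultimately show ?case
  proof eventually_elim
    case (elim t)
    have "orb t (Suc i) - orb t i < 2 * pi" using orb_step(2)[of t i] elim by simp
    with elim \<sigma>'(2)[of "orb t (Suc i) - orb t i" "orb t (Suc i)"] show ?case by simp
  qed
qed

lemma orb_exceeds_near_full_turn:
  "\<forall>\<^sub>F t in at_left (2 * pi). real (Suc k) * tau < orb t (Suc k)"
proof (induction k)
  case 0
  show ?case using orb_steps_near_full_turn[OF tau(1,2), of 0] by simp
next
  case (Suc k)
  show ?case using Suc.IH orb_steps_near_full_turn[OF tau(1,2), of "Suc k"]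
  proof eventually_elim
    case (elim t)
    have "real (Suc (Suc k)) * tau = real (Suc k) * tau + tau" by (simp add: algebra_simps)
    with elim show ?case by linarith
  qed
qed

text \<open>The derivative at the star polygon puts \<open>orb t K\<close> below the target just
  after \<open>tau\<close>, near a full turn it is above, and the intermediate value theorem
  applies.\<close>

lemma ex_orb_eq:
  assumes "(1 + cos \<theta>) * (1 - e + (real N)\<^sup>2 * e) = 2 * (1 - e)" and "0 < sin \<theta>" and "sin (real K * \<theta>) < 0"
  shows "\<exists>t. tau < t \<and> t < 2 * pi \<and> orb t K = real K * tau"
proof -
  from assms(3) obtain k where k: "K = Suc k" by (cases K) auto
  have "sin (real K * \<theta>) / sin \<theta> < 0" using assms by (simp add: divide_neg_pos)
  moreover have "((\<lambda>t. orb t K) has_real_derivative sin (real K * \<theta>) / sin \<theta>) (at tau)"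
    using assms by (intro orb_has_derivative) auto
  ultimately obtain d where d: "0 < d" "\<And>x. 0 < x \<Longrightarrow> x < d \<Longrightarrow> orb (tau + x) K < orb tau K"
    using DERIV_neg_dec_right by metis
  \<comment> \<open>Half of each distance stays within the range of local decrease and below
    \<open>2 * pi\<close>.\<close>
  define t1 where "t1 = tau + min (d / 2) ((2 * pi - tau) / 2)"
  have t1: "tau < t1" "t1 < 2 * pi" "orb t1 K < real K * tau"
    using d(2)[of "min (d / 2) ((2 * pi - tau) / 2)"] d(1) tau
    by (auto simp: t1_def orb_tau min_def field_simps)
  have "\<forall>\<^sub>F t in at_left (2 * pi). t \<in> {t1<..<2 * pi} \<and> real K * tau < orb t K"
    using orb_exceeds_near_full_turn[of k] eventually_at_left_real[OF t1(2)] unfolding k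
    by eventually_elim auto
  then obtain t2 where t2: "t1 < t2" "t2 < 2 * pi" "real K * tau < orb t2 K"
    using eventually_happens[of _ "at_left (2 * pi)"] by auto
  have "\<exists>t\<ge>t1. t \<le> t2 \<and> orb t K = real K * tau"
    using t1 t2 tau isCont_orb by (intro IVT) auto
  then obtain t where "t1 \<le> t" "t \<le> t2" "orb t K = real K * tau" by blast
  with t1 t2 show ?thesis by (intro exI[of _ t]) auto
qed

text \<open>The past is the mirror image of the future in the axis through the starting point. This
  makes the reflection law at index 0 automatic, and \<open>orbZ\<close> odd.\<close>

definition orbZ :: "real \<Rightarrow> int \<Rightarrow> real" where
  "orbZ t i = (if 0 \<le> i then orb t (nat i) else - orb t (nat (- i)))"

lemma orbZ_minus: "orbZ t (- i) = - orbZ t i"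
  by (cases i "0 :: int" rule: linorder_cases) (auto simp: orbZ_def)

lemma orbZ_of_nat: "orbZ t (int i) = orb t i"
  by (simp add: orbZ_def)

lemma orbZ_step:
  assumes "0 < t" "t < 2 * pi"
  shows "orbZ t i < orbZ t (i + 1)" "orbZ t (i + 1) < orbZ t i + 2 * pi"
proof -
  have nonneg: "orbZ t j < orbZ t (j + 1) \<and> orbZ t (j + 1) < orbZ t j + 2 * pi" if "0 \<le> j" for j
  proof -
    define k where "k = nat j"
    then have "j = int k" using that by simp
    then show ?thesis
      using orb_step[OF assms, of k] orbZ_of_nat[of t k] orbZ_of_nat[of t "Suc k"]
      by (simp add: add.commute)
  qed
  have "orbZ t i < orbZ t (i + 1) \<and> orbZ t (i + 1) < orbZ t i + 2 * pi"
  proof (cases "0 \<le> i")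
    case False
    then have "0 \<le> - i - 1" by simp
    from nonneg[OF this] orbZ_minus[of t "i + 1"] orbZ_minus[of t i] show ?thesis by simp
  qed (rule nonneg)
  then show "orbZ t i < orbZ t (i + 1)" "orbZ t (i + 1) < orbZ t i + 2 * pi" by auto
qed

lemma orbZ_law: "Q (orbZ t i) (orbZ t (i + 1)) = - Q (orbZ t i) (orbZ t (i - 1))"
proof -
  have pos: "Q (orbZ t j) (orbZ t (j + 1)) = - Q (orbZ t j) (orbZ t (j - 1))" if "0 < j" for j
  proof -
    define k where "k = nat (j - 1)"
    then have j: "j = int (Suc k)" "j + 1 = int (Suc (Suc k))" "j - 1 = int k" using that by auto
    show ?thesis unfolding j(2,3) unfolding j(1) orbZ_of_nat by (rule orb_law)
  qed
  show ?thesis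
  proof (cases i "0 :: int" rule: linorder_cases)
    case less
    then show ?thesis
      using pos[of "- i"] orbZ_minus[of t i] orbZ_minus[of t "i - 1"] orbZ_minus[of t "i + 1"]
      by (simp add: Q_minus)
  next
    case equal
    then show ?thesis
      using Q_minus[of 0 "orbZ t 1"] orbZ_minus[of t 1] by (simp add: orbZ_def)
  qed (rule pos)
qed

text \<open>Vertex \<open>K\<close> lies on a symmetry axis, so reflecting the orbit there and
  reversing its direction gives an orbit through the same vertex. By the reflection law at that
  vertex the two also share the next one, and two consecutive vertices determine all the
  others.\<close>

lemma orbZ_reflect:
  assumes t: "0 < t" "t < 2 * pi" and K: "orb t K = real K * tau"
  shows "orbZ t (int K + j) = of_int (2 * int K) * tau - orbZ t (int K - j)"
proof -
  let ?c = "of_int (2 * int K) * tau"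
  have step: "orbZ t (int K + (j + 1)) = ?c - orbZ t (int K - (j + 1))"
    if 1: "orbZ t (int K + j) = ?c - orbZ t (int K - j)"
      and 2: "Q (orbZ t (int K + j)) (orbZ t (int K + (j - 1))) = Q (?c - orbZ t (int K - j)) (?c - orbZ t (int K - (j - 1)))" for j
  proof (rule Q_inj)
    have "Q (orbZ t (int K + j)) (orbZ t (int K + (j + 1))) = - Q (orbZ t (int K + j)) (orbZ t (int K + (j - 1)))"
      using orbZ_law[of t "int K + j"] by (simp add: algebra_simps)
    also have "\<dots> = Q (orbZ t (int K - j)) (orbZ t (int K - (j - 1)))"
      unfolding 2 Q_reflect by simp
    also have "\<dots> = - Q (orbZ t (int K - j)) (orbZ t (int K - (j + 1)))"
      using orbZ_law[of t "int K - j"] by (simp add: algebra_simps)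
    also have "\<dots> = Q (?c - orbZ t (int K - j)) (?c - orbZ t (int K - (j + 1)))"
      by (simp only: Q_reflect)
    finally show "Q (orbZ t (int K + j)) (orbZ t (int K + (j + 1))) = Q (orbZ t (int K + j)) (?c - orbZ t (int K - (j + 1)))"
      using 1 by simp
    show "orbZ t (int K + j) < orbZ t (int K + (j + 1))" "orbZ t (int K + (j + 1)) < orbZ t (int K + j) + 2 * pi"
      using orbZ_step[OF t, of "int K + j"] by (simp_all add: add.assoc)
    have "int K - (j + 1) + 1 = int K - j" by simp
    then show "orbZ t (int K + j) < ?c - orbZ t (int K - (j + 1))" "?c - orbZ t (int K - (j + 1)) < orbZ t (int K + j) + 2 * pi"
      using orbZ_step[OF t, of "int K - (j + 1)"] 1 by simp_all
  qed
  have base: "orbZ t (int K + 0) = ?c - orbZ t (int K - 0)"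
    using K by (simp add: orbZ_of_nat algebra_simps)
  have nat: "orbZ t (int K + int j) = ?c - orbZ t (int K - int j)" for j
  proof (induction j rule: induct_nat_012)
    case 0
    show ?case using base by simp
  next
    case 1
    have "Q (orbZ t (int K)) (orbZ t (int K + 1)) = - Q (orbZ t (int K)) (orbZ t (int K - 1))" 
      by (rule orbZ_law)
    also have "\<dots> = Q (?c - orbZ t (int K)) (?c - orbZ t (int K - 1))" by (simp only: Q_reflect)
    finally have eq: "Q (orbZ t (int K)) (orbZ t (int K + 1)) = Q (orbZ t (int K)) (?c - orbZ t (int K - 1))"
      using base by simp
    have "orbZ t (int K + 1) = ?c - orbZ t (int K - 1)"
      using orbZ_step[OF t, of "int K"] orbZ_step[OF t, of "int K - 1"] base eq
      by (intro Q_inj[OF _ _ _ _ eq]) auto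
    then show ?case by simp
  next
    case (ge2 j)
    have j: "int (Suc j) - 1 = int j" "int (Suc j) + 1 = int (Suc (Suc j))" by auto
    show ?case by (rule step[OF ge2(2), unfolded j]) (simp only: ge2)
  qed
  show ?thesis
  \<comment> \<open>The identity for \<open>- j\<close> is a rearrangement of the one for
    \<open>j\<close>.\<close>
  proof (cases "0 \<le> j")
    case True
    then show ?thesis using nat[of "nat j"] by simp
  next
    case False
    then show ?thesis using nat[of "nat (- j)"] by simp
  qed
qed

text \<open>The reversals about the indices 0 and \<open>K\<close> compose to a shift of the index
  by \<open>2 * K\<close>.\<close>

lemma orbZ_periodic:
  assumes "0 < t" "t < 2 * pi" "orb t K = real K * tau"
  shows "orbZ t (i + 2 * int K) = orbZ t i + of_int (2 * int K) * tau"
  using orbZ_reflect[OF assms, of "i + int K"] orbZ_minus[of t i] by (simp add: algebra_simps)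

section \<open>Convexity, analyticity and non-Birkhoff orbits\<close>

definition gam :: "real \<Rightarrow> real \<times> real" where "gam x = Gam (2 * pi * x)"

lemma Gam_neq: "cos (\<psi> - \<phi>) < 1 \<Longrightarrow> Gam \<psi> \<noteq> Gam \<phi>"
  using nb_pos[of \<psi> \<phi>] Gam_diff_normal[of \<psi> \<phi>] by auto

lemma gam_eqD:
  assumes "gam s = gam x"
  shows "\<exists>k::int. s = x + of_int k"
proof -
  have "\<not> cos (2 * pi * s - 2 * pi * x) < 1"
    using Gam_neq[of "2 * pi * s" "2 * pi * x"] assms by (auto simp: gam_def)
  then have "cos (2 * pi * s - 2 * pi * x) = 1"
    using cos_le_one[of "2 * pi * s - 2 * pi * x"] by linarith
  then obtain k :: int where "2 * pi * s - 2 * pi * x = of_int k * 2 * pi"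
    using cos_one_2pi_int by blast
  then have "2 * pi * s = 2 * pi * (x + of_int k)" by (simp add: algebra_simps)
  then have "s = x + of_int k" by (simp only: mult_cancel_left) simp
  then show ?thesis ..
qed

lemma gam_has_vector_derivative:
  "(gam has_vector_derivative ((2 * pi * R (2 * pi * x)) *\<^sub>R (- sin (2 * pi * x), cos (2 * pi * x)))) (at x)"
proof -
  have "((\<lambda>x. 2 * pi * x) has_vector_derivative 2 * pi) (at x)"
    by (auto intro!: derivative_eq_intros simp flip: has_real_derivative_iff_has_vector_derivative)
  from vector_diff_chain_at[OF this Gam_has_vector_derivative]
  show ?thesis by (simp add: o_def gam_def[abs_def] mult.assoc)
qed

lemma inner_Gam: "inner (Gam \<psi>) (cos \<phi>, sin \<phi>) = h \<phi> - nb \<phi> \<psi>"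
proof -
  have "(sin \<phi>)\<^sup>2 + (cos \<phi>)\<^sup>2 = 1" by simp
  then have "inner (Gam \<phi>) (cos \<phi>, sin \<phi>) = h \<phi>"
    unfolding Gam_def inner_prod_def fst_conv snd_conv inner_real_def by algebra
  then show ?thesis using Gam_diff_normal[of \<psi> \<phi>] by (simp add: inner_diff_left)
qed

text \<open>The difference between \<open>h\<close> and the inner product is minimal at \<phi>, so
  its derivative vanishes there. Together with equality of the values this gives two linear
  equations that determine \<open>p\<close>.\<close>

lemma eq_Gam_of_touching:
  assumes le: "\<And>\<psi>. inner p (cos \<psi>, sin \<psi>) \<le> h \<psi>" and eq: "inner p (cos \<phi>, sin \<phi>) = h \<phi>"
  shows "p = Gam \<phi>"
proof -
  obtain a b where p: "p = (a, b)" by (cases p)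
  have D: "((\<lambda>\<psi>. h \<psi> - (a * cos \<psi> + b * sin \<psi>)) has_real_derivative (h' \<phi> - (- a * sin \<phi> + b * cos \<phi>))) (at \<phi>)"
    by (auto intro!: derivative_eq_intros)
  have 1: "h' \<phi> - (- a * sin \<phi> + b * cos \<phi>) = 0"
    by (rule DERIV_local_min[OF D zero_less_one]) (use le eq in \<open>auto simp: p\<close>)
  have 2: "a * cos \<phi> + b * sin \<phi> = h \<phi>" using eq by (simp add: p)
  have 3: "(sin \<phi>)\<^sup>2 + (cos \<phi>)\<^sup>2 = 1" by simp
  have "a = h \<phi> * cos \<phi> - h' \<phi> * sin \<phi>" "b = h \<phi> * sin \<phi> + h' \<phi> * cos \<phi>"
    using 1 2 3 by algebra+
  then show ?thesis by (simp add: p Gam_def)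
qed

definition Dom :: "(real \<times> real) set" where
  "Dom = {p. \<forall>\<phi>. inner p (cos \<phi>, sin \<phi>) < h \<phi>}"

text \<open>\<open>Dom\<close> is an infinite intersection of open half-planes; compactness of one
  period of angles supplies a positive distance \<mu> that serves all of them.\<close>

lemma open_Dom: "open Dom"
  unfolding open_contains_ball
proof
  fix p assume p: "p \<in> Dom"
  have cont: "continuous_on {0..2 * pi} (\<lambda>\<phi>. h \<phi> - inner p (cos \<phi>, sin \<phi>))"
    unfolding h_def by (intro continuous_intros)
  obtain x where x: "\<And>\<phi>. \<phi> \<in> {0..2 * pi} \<Longrightarrow> h x - inner p (cos x, sin x) \<le> h \<phi> - inner p (cos \<phi>, sin \<phi>)"
    using continuous_attains_inf[OF compact_Icc _ cont] pi_ge_zero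
    by (metis atLeastAtMost_iff empty_iff order_refl mult_nonneg_nonneg zero_le_numeral)
  define \<mu> where "\<mu> = h x - inner p (cos x, sin x)"
  have "0 < \<mu>" using p by (simp add: \<mu>_def Dom_def)
  moreover have "ball p \<mu> \<subseteq> Dom"
  proof
    fix q assume q: "q \<in> ball p \<mu>"
    show "q \<in> Dom" unfolding Dom_def
    proof (intro CollectI allI)
      fix \<phi>
      obtain \<psi> k where \<psi>: "0 \<le> \<psi>" "\<psi> < 2 * pi" "\<phi> = \<psi> + 2 * pi * of_int k"
        by (rule ex_angle_in_period)
      have "inner (q - p) (cos \<psi>, sin \<psi>) \<le> norm (q - p) * norm (cos \<psi>, sin \<psi>)"
        by (rule norm_cauchy_schwarz)
      also have "\<dots> < \<mu>" using q by (simp add: norm_Pair dist_norm norm_minus_commute)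
      finally have "inner q (cos \<psi>, sin \<psi>) < h \<psi>"
        using x[of \<psi>] \<psi> by (simp add: inner_diff_left \<mu>_def)
      then show "inner q (cos \<phi>, sin \<phi>) < h \<phi>"
        unfolding \<psi>(3) h_period cos_add_2pi_int sin_add_2pi_int .
    qed
  qed
  ultimately show "\<exists>e>0. ball p e \<subseteq> Dom" by blast
qed

lemma closure_Dom_le:
  assumes "p \<in> closure Dom"
  shows "inner p (cos \<phi>, sin \<phi>) \<le> h \<phi>"
proof -
  have "closed {p. inner p (cos \<phi>, sin \<phi>) \<le> h \<phi>}"
    by (intro closed_Collect_le continuous_intros)
  moreover have "Dom \<subseteq> {p. inner p (cos \<phi>, sin \<phi>) \<le> h \<phi>}"
    by (auto simp: Dom_def intro: less_imp_le)
  ultimately have "closure Dom \<subseteq> {p. inner p (cos \<phi>, sin \<phi>) \<le> h \<phi>}"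
    by (rule closure_minimal[rotated])
  with assms show ?thesis by auto
qed

text \<open>Points of the curve are approached by shrinking towards the origin; since
  \<open>h\<close> is positive, shrinking makes every half-plane inequality strict.\<close>

lemma Gam_in_closure_Dom: "Gam \<phi> \<in> closure Dom"
proof -
  have "(1 - 1 / real (Suc k)) *\<^sub>R Gam \<phi> \<in> Dom" for k
    unfolding Dom_def
  proof (intro CollectI allI)
    fix \<psi>
    have "(1 - 1 / real (Suc k)) * inner (Gam \<phi>) (cos \<psi>, sin \<psi>) \<le> (1 - 1 / real (Suc k)) * h \<psi>"
      using nb_nonneg[of \<psi> \<phi>] by (intro mult_left_mono) (auto simp: inner_Gam)
    also have "\<dots> < 1 * h \<psi>"
      using h_bounds(1)[of \<psi>] by (intro mult_strict_right_mono) auto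
    finally show "inner ((1 - 1 / real (Suc k)) *\<^sub>R Gam \<phi>) (cos \<psi>, sin \<psi>) < h \<psi>" by simp
  qed
  moreover have "(\<lambda>k. (1 - 1 / real (Suc k)) *\<^sub>R Gam \<phi>) \<longlonglongrightarrow> (1 - 0) *\<^sub>R Gam \<phi>"
    by (intro tendsto_intros LIMSEQ_Suc lim_1_over_n)
  ultimately show ?thesis unfolding closure_sequential by force
qed

lemma strictly_convex_Dom: "strictly_convex_domain Dom"
  unfolding strictly_convex_domain_def
proof (intro conjI ballI impI open_Dom)
  have "norm p \<le> 4" if "p \<in> Dom" for p
  proof -
    have d: "inner p (cos \<phi>, sin \<phi>) \<le> 3/2" for \<phi>
    proof -
      have "inner p (cos \<phi>, sin \<phi>) < h \<phi>" using that by (simp add: Dom_def)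
      with h_bounds(2)[of \<phi>] show ?thesis by linarith
    qed
    have "\<bar>fst p\<bar> \<le> 3/2" "\<bar>snd p\<bar> \<le> 3/2"
      using d[of 0] d[of pi] d[of "pi/2"] d[of "- pi/2"] by (auto simp: inner_prod_def abs_le_iff)
    then show ?thesis using norm_Pair_le[of "fst p" "snd p"] by simp
  qed
  then show "bounded Dom" unfolding bounded_iff by blast
  have "0 \<in> Dom" using h_bounds(1) by (auto simp: Dom_def intro: less_le_trans[of 0 "1/2"])
  then show "Dom \<noteq> {}" by auto
  have "Dom = (\<Inter>\<phi>. {p. inner (cos \<phi>, sin \<phi>) p < h \<phi>})"
    by (auto simp: Dom_def inner_commute)
  then show "convex Dom" by (simp add: convex_INT convex_halfspace_lt)
next
  fix p q assume pq: "p \<in> closure Dom" "q \<in> closure Dom" "p \<noteq> q"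
  show "open_segment p q \<subseteq> Dom"
  proof
    fix r assume "r \<in> open_segment p q"
    then obtain s where s: "0 < s" "s < 1" "r = (1 - s) *\<^sub>R p + s *\<^sub>R q"
      by (auto simp: in_segment)
    have "inner r (cos \<phi>, sin \<phi>) < h \<phi>" for \<phi>
    proof -
      have le: "inner p (cos \<phi>, sin \<phi>) \<le> h \<phi>" "inner q (cos \<phi>, sin \<phi>) \<le> h \<phi>"
        using pq closure_Dom_le by auto
      \<comment> \<open>If both endpoints lay on the tangent line at \<phi>, both would equal
        \<open>Gam \<phi>\<close>.\<close>
      have "inner p (cos \<phi>, sin \<phi>) \<noteq> h \<phi> \<or> inner q (cos \<phi>, sin \<phi>) \<noteq> h \<phi>"
        using pq eq_Gam_of_touching[of p \<phi>] eq_Gam_of_touching[of q \<phi>] closure_Dom_le by metis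
      with le have "inner p (cos \<phi>, sin \<phi>) < h \<phi> \<or> inner q (cos \<phi>, sin \<phi>) < h \<phi>" by linarith
      then have "(1 - s) * inner p (cos \<phi>, sin \<phi>) + s * inner q (cos \<phi>, sin \<phi>) < (1 - s) * h \<phi> + s * h \<phi>"
        using s le by (auto intro: add_less_le_mono add_le_less_mono mult_left_mono mult_strict_left_mono)
      then show ?thesis by (simp add: s(3) inner_add_left algebra_simps)
    qed
    then show "r \<in> Dom" by (simp add: Dom_def)
  qed
qed

lemma frontier_Dom: "frontier Dom = gam ` {0..1}"
proof
  show "frontier Dom \<subseteq> gam ` {0..1}"
  proof
    fix p assume "p \<in> frontier Dom"
    then have p: "p \<in> closure Dom" "p \<notin> Dom"
      using open_Dom by (auto simp: frontier_def interior_open)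
    then obtain \<phi> where "h \<phi> \<le> inner p (cos \<phi>, sin \<phi>)" by (auto simp: Dom_def not_less)
    then have "p = Gam \<phi>"
      using closure_Dom_le[OF p(1)] by (intro eq_Gam_of_touching) (auto intro: antisym)
    moreover obtain \<psi> k where \<psi>: "0 \<le> \<psi>" "\<psi> < 2 * pi" "\<phi> = \<psi> + 2 * pi * of_int k"
      by (rule ex_angle_in_period)
    ultimately have "p = gam (\<psi> / (2 * pi))" by (simp add: gam_def Gam_period)
    then show "p \<in> gam ` {0..1}" using \<psi> by auto
  qed
  show "gam ` {0..1} \<subseteq> frontier Dom"
  proof
    fix p assume "p \<in> gam ` {0..1}"
    then obtain \<phi> where p: "p = Gam \<phi>" by (auto simp: gam_def)
    have "inner p (cos \<phi>, sin \<phi>) = h \<phi>" by (simp add: p inner_Gam nb_def)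
    then have "p \<notin> Dom" unfolding Dom_def mem_Collect_eq by (metis less_irrefl)
    then show "p \<in> frontier Dom"
      using Gam_in_closure_Dom open_Dom by (simp add: p frontier_def interior_open)
  qed
qed

lemma bounds_strictly_convex_gam: "bounds_strictly_convex_domain gam"
  unfolding bounds_strictly_convex_domain_def
proof (intro conjI allI exI[of _ Dom] strictly_convex_Dom frontier_Dom)
  fix x
  show "gam (x + 1) = gam x"
    using Gam_period[of "2 * pi * x" 1] by (simp add: gam_def algebra_simps)
  show "gam differentiable (at x)"
    using gam_has_vector_derivative by (rule differentiableI_vector)
  have "(- sin (2 * pi * x), cos (2 * pi * x)) \<noteq> 0"
    using sin_zero_abs_cos_one[of "2 * pi * x"] by (auto simp: zero_prod_def)
  then show "vector_derivative gam (at x) \<noteq> 0"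
    using R_pos[of "2 * pi * x"] unfolding vector_derivative_at[OF gam_has_vector_derivative] scaleR_eq_0_iff by simp
next
  show "continuous_on UNIV gam"
    by (intro continuous_at_imp_continuous_on ballI)
      (rule has_vector_derivative_continuous[OF gam_has_vector_derivative])
  show "inj_on gam {0..<1}"
  proof (rule inj_onI)
    fix x y assume xy: "x \<in> {0..<1}" "y \<in> {0..<1}" "gam x = gam y"
    then obtain k :: int where k: "x = y + of_int k" using gam_eqD by blast
    with xy have "of_int k < (1::real)" "- 1 < (of_int k::real)" by auto
    then have "k = 0" by linarith
    with k show "x = y" by simp
  qed
qed

text \<open>The same formulas define entire functions. Their deviation from the circle consists of
  products of one factor of frequency \<open>N\<close> and one of frequency 1, which grow
  exponentially in the imaginary part; the factor 2 accounts for the two coordinates.\<close>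

lemma holo_close_gam:
  assumes "2 * e * (1 + real N) * exp (2 * pi * (1 + real N) * \<rho>) < \<epsilon>"
  shows "holo_close_to_circle gam \<rho> \<epsilon>"
proof -
  define H where "H w = 1 - of_real e * cos (of_nat N * (2 * of_real pi * w))" for w :: complex
  define H' where "H' w = of_real e * of_nat N * sin (of_nat N * (2 * of_real pi * w))" for w :: complex
  define G1 where "G1 w = H w * cos (2 * of_real pi * w) - H' w * sin (2 * of_real pi * w)" for w
  define G2 where "G2 w = H w * sin (2 * of_real pi * w) + H' w * cos (2 * of_real pi * w)" for w
  define X where "X = exp (2 * pi * (1 + real N) * \<rho>)"
  have real: "G1 (of_real x) = of_real (fst (gam x)) \<and> G2 (of_real x) = of_real (snd (gam x))" for x
  proof -
    have "2 * of_real pi * of_real x = (of_real (2 * pi * x) :: complex)"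
      "of_nat N * of_real (2 * pi * x) = (of_real (real N * (2 * pi * x)) :: complex)" by simp_all
    then show ?thesis
      unfolding G1_def G2_def H_def H'_def
      by (simp only: cos_of_real sin_of_real) (simp add: gam_def Gam_def h_def h'_def)
  qed
  have bound: "sqrt ((cmod (G1 w - cos (2 * of_real pi * w)))\<^sup>2 + (cmod (G2 w - sin (2 * of_real pi * w)))\<^sup>2)
      \<le> 2 * e * (1 + real N) * X" if "w \<in> strip \<rho>" for w
  proof -
    define v where "v = 2 * of_real pi * w"
    define u where "u = of_nat N * v"
    have "\<bar>Im u\<bar> + \<bar>Im v\<bar> = 2 * pi * (1 + real N) * \<bar>Im w\<bar>"
      by (simp add: u_def v_def abs_mult algebra_simps)
    also have "\<dots> \<le> 2 * pi * (1 + real N) * \<rho>"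
      using that by (intro mult_left_mono) (auto simp: strip_def)
    finally have X: "exp \<bar>Im u\<bar> * exp \<bar>Im v\<bar> \<le> X" by (simp add: X_def flip: exp_add)
    have prod: "cmod (of_real e * a * b) \<le> e * X" "cmod (of_real e * of_nat N * a * b) \<le> e * real N * X"
      if "cmod a \<le> exp \<bar>Im u\<bar>" "cmod b \<le> exp \<bar>Im v\<bar>" for a b
    proof -
      have "cmod a * cmod b \<le> exp \<bar>Im u\<bar> * exp \<bar>Im v\<bar>"
        by (intro mult_mono that) auto
      also note X
      finally have "cmod a * cmod b \<le> X" .
      then show "cmod (of_real e * a * b) \<le> e * X" "cmod (of_real e * of_nat N * a * b) \<le> e * real N * X"
        using e_pos by (simp_all add: norm_mult mult.assoc mult_left_mono)
    qed
    have "G1 w - cos v = - (of_real e * cos u * cos v) - of_real e * of_nat N * sin u * sin v"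
      by (simp add: G1_def H_def H'_def u_def v_def algebra_simps)
    also have "cmod \<dots> \<le> e * X + e * real N * X"
      by (intro order_trans[OF norm_triangle_ineq4] add_mono) (simp_all only: norm_minus_cancel prod norm_cos_sin_le)
    finally have 1: "cmod (G1 w - cos v) \<le> e * X + e * real N * X" .
    have "G2 w - sin v = - (of_real e * cos u * sin v) + of_real e * of_nat N * sin u * cos v"
      by (simp add: G2_def H_def H'_def u_def v_def algebra_simps)
    also have "cmod \<dots> \<le> e * X + e * real N * X"
      by (intro order_trans[OF norm_triangle_ineq] add_mono) (simp_all only: norm_minus_cancel prod norm_cos_sin_le)
    finally have 2: "cmod (G2 w - sin v) \<le> e * X + e * real N * X" .
    have "sqrt ((cmod (G1 w - cos v))\<^sup>2 + (cmod (G2 w - sin v))\<^sup>2) \<le> cmod (G1 w - cos v) + cmod (G2 w - sin v)"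
      by (rule sqrt_sum_squares_le_sum) auto
    with 1 2 show ?thesis unfolding v_def by (simp add: algebra_simps)
  qed
  show ?thesis
    unfolding holo_close_to_circle_def
  proof (intro exI conjI ballI allI)
    show "open UNIV" "strip \<rho> \<subseteq> UNIV" by auto
    show "G1 holomorphic_on UNIV" "G2 holomorphic_on UNIV"
      unfolding G1_def G2_def H_def H'_def by (auto intro!: holomorphic_intros)
    show "2 * e * (1 + real N) * X < \<epsilon>" using assms by (simp add: X_def)
  qed (use real bound in auto)
qed

section \<open>Billiard orbits obtained from the angle sequences\<close>

definition orbit :: "real \<Rightarrow> int \<Rightarrow> real \<times> real" where "orbit t i = Gam (orbZ t i)"

lemma billiard_orbit_orbit:
  assumes t: "0 < t" "t < 2 * pi"
  shows "billiard_orbit gam (orbit t)"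
  unfolding billiard_orbit_def
proof (intro conjI allI impI)
  fix i
  have c: "cos (orbZ t (j + 1) - orbZ t j) < 1" for j
    using orbZ_step[OF t] by (intro cos_less_one_between)
  have g: "orbit t j = gam (orbZ t j / (2 * pi))" for j by (simp add: orbit_def gam_def)
  show "orbit t i \<in> range gam" by (simp add: g)
  show "orbit t i \<noteq> orbit t (i + 1)" using Gam_neq[OF c] unfolding orbit_def by metis
  fix s assume s: "gam s = orbit t i"
  \<comment> \<open>The law is required for every parameter of the impact point; these differ by
    integers and share one tangent vector.\<close>
  then obtain k :: int where "s = orbZ t i / (2 * pi) + of_int k" unfolding g using gam_eqD by blast
  then have k: "2 * pi * s = orbZ t i + 2 * pi * of_int k" by (simp add: algebra_simps)
  have "cos (orbZ t (i - 1) - orbZ t i) < 1" using c[of "i - 1"] by (simp add: cos_less_one_swap)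
  from reflection_of_Q[OF this c orbZ_law]
  show "reflection_law gam s (orbit t (i - 1)) (orbit t (i + 1))"
    unfolding reflection_law_def Let_def s vector_derivative_at[OF gam_has_vector_derivative] k
      cos_add_2pi_int sin_add_2pi_int unfolding orbit_def .
qed

lemma orbZ_periodic_iterate:
  assumes "0 < t" "t < 2 * pi" "orb t K = real K * tau"
  shows "orbZ t (i + 2 * int K * int j) = orbZ t i + of_int (2 * int K * int j) * tau"
proof (induction j)
  case (Suc j)
  then show ?case
    using orbZ_periodic[OF assms, of "i + 2 * int K * int j"] by (simp add: algebra_simps)
qed simp

text \<open>With \<open>K = c * N + 1\<close>, the indices \<open>-1\<close> and \<open>1\<close>
  differ by \<open>2 * K\<close> minus a multiple of \<open>N\<close>. The period and the shift that
  a Birkhoff lift would satisfy then give two values for the same vertex, which forces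
  \<open>t = tau\<close>.\<close>

lemma nonbirkhoff_orbit:
  assumes t: "tau < t" "t < 2 * pi" and K: "orb t K = real K * tau" "K mod N = 1"
  shows "nonbirkhoff_periodic_orbit gam (of_int m / real N) (orbit t)"
proof -
  have t0: "0 < t" using t tau by simp
  note per = orbZ_periodic_iterate[OF t0 t(2) K(1)]
  have Kpos: "0 < K" using K(2) by (cases K) auto
  have Npos: "0 < N" using N_ge by simp
  have tauN: "real N * tau = 2 * pi * of_int m" using Npos by (simp add: tau_def)
  define X where "X i = orbZ t i / (2 * pi)" for i
  \<comment> \<open>A shift by \<open>2 * K\<close> advances the lift by
    \<open>2 * K * m / N\<close> turns, so \<open>N\<close> such shifts are combined to reach an
    integer.\<close>
  have perX: "X (i + int (2 * K) * int N) = X i + of_int (int (2 * K) * m)" for i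
  proof -
    have "orbZ t (i + 2 * int K * int N) = orbZ t i + real (2 * K) * (real N * tau)"
      using per[of i N] by simp
    then show ?thesis unfolding tauN X_def by (simp add: add_divide_distrib)
  qed
  show ?thesis
    unfolding nonbirkhoff_periodic_orbit_def
  proof (intro conjI exI[of _ X])
    show "billiard_orbit gam (orbit t)" using t0 t(2) by (rule billiard_orbit_orbit)
    have o: "orbit t i = gam (X i)" for i by (simp add: orbit_def gam_def X_def)
    have gp: "gam (x + of_int k) = gam x" for x k
      using Gam_period[of "2 * pi * x" k] by (simp add: gam_def algebra_simps)
    show "periodic_seq (orbit t)"
      unfolding periodic_seq_def o
      by (rule exI[of _ "int (2 * K) * int N"]) (use Kpos Npos in \<open>auto simp only: perX gp, simp\<close>)
    show "is_lift gam (orbit t) X"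
      using orbZ_step[OF t0 t(2)] unfolding is_lift_def o
      by (auto simp: X_def field_simps)
    show "has_rotation_number X (of_int m / real N)"
    proof -
      \<comment> \<open>The deviation from the star polygon has period \<open>2 * K\<close>, hence
        is bounded and vanishes after division by the index.\<close>
      define y where "y i = orb t i - real i * tau" for i
      have "y (i + 2 * K * j) = y i" for i j
      proof -
        have "orb t (i + 2 * K * j) = orbZ t (int i + 2 * int K * int j)"
          using orbZ_of_nat[of t "i + 2 * K * j"] by simp
        also have "\<dots> = orb t i + of_int (2 * int K * int j) * tau"
          unfolding per orbZ_of_nat ..
        finally show ?thesis by (simp add: y_def algebra_simps)
      qed
      from this[of "i mod (2 * K)" "i div (2 * K)" for i] have ym: "y i = y (i mod (2 * K))" for i
        by simp
      define B where "B = Max ((\<lambda>i. \<bar>y i\<bar>) ` {..<2 * K})"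
      have yB: "\<bar>y i\<bar> \<le> B" for i
        unfolding B_def by (subst ym) (use Kpos in \<open>auto intro!: Max_ge\<close>)
      have "(\<lambda>i. B * (1 / real i)) \<longlonglongrightarrow> B * 0"
        by (intro tendsto_intros lim_1_over_n)
      then have "(\<lambda>i. B * (1 / real i)) \<longlonglongrightarrow> 0" by simp
      moreover have "\<forall>i. norm (y i / real i) \<le> B * (1 / real i)"
        using divide_right_mono[OF yB, of "real _"] by simp
      ultimately have "(\<lambda>i. y i / real i) \<longlonglongrightarrow> 0"
        by (rule Lim_null_comparison[OF always_eventually, rotated])
      then have "(\<lambda>i. tau / (2 * pi) + (y i / real i) / (2 * pi)) \<longlonglongrightarrow> tau / (2 * pi) + 0 / (2 * pi)"
        by (intro tendsto_intros) auto
      moreover have "tau / (2 * pi) + 0 / (2 * pi) = of_int m / real N" by (simp add: tau_def)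
      moreover have "\<forall>\<^sub>F i in sequentially. tau / (2 * pi) + (y i / real i) / (2 * pi) = X (int i) / real i"
        using eventually_gt_at_top[of 0]
        by eventually_elim (simp add: X_def orbZ_of_nat y_def field_simps)
      ultimately show ?thesis
        unfolding has_rotation_number_def by (simp add: tendsto_cong)
    qed
    show "\<not> birkhoff_lift X"
    proof
      assume "birkhoff_lift X"
      then have shift: "X (i + int N) = X i + of_int m" for i
        by (rule birkhoff_lift_shift[where P = "2 * K"]) (use perX Kpos in simp_all)
      have shift_iter: "X (i + int j * int N) = X i + real j * of_int m" for i j
      proof (induction j)
        case (Suc j)
        then show ?case using shift[of "i + int j * int N"] by (simp add: algebra_simps)
      qed simp
      define c where "c = K div N"
      have Kc: "K = c * N + 1" using div_mult_mod_eq[of K N] K(2) by (simp add: c_def)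
      have "orbZ t (- 1 + 2 * int K * int 1) = orbZ t (- 1) + of_int (2 * int K * int 1) * tau"
        by (rule per)
      then have "2 * pi * X (- 1 + 2 * int K) = - t + 2 * real K * tau"
        using orbZ_minus[of t 1] by (simp add: X_def orbZ_def)
      moreover have "- 1 + 2 * int K = 1 + int (2 * c) * int N" by (simp add: Kc algebra_simps)
      ultimately have "2 * pi * (X 1 + real (2 * c) * of_int m) = - t + 2 * real K * tau"
        by (simp only: shift_iter)
      then have "2 * pi * X 1 + 2 * pi * (real (2 * c) * of_int m) = - t + 2 * real K * tau"
        by (simp only: distrib_left)
      moreover have "2 * pi * X 1 = t" by (simp add: X_def orbZ_def)
      moreover have "2 * pi * (real (2 * c) * of_int m) = 2 * real c * (real N * tau)"
        unfolding tauN by simp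
      ultimately have "t + 2 * real c * (real N * tau) = - t + 2 * real K * tau" by argo
      then have "t = tau" by (simp add: Kc algebra_simps)
      with t show False by simp
    qed
  qed
qed

lemma infinite_nonbirkhoff:
  assumes \<theta>: "(1 + cos \<theta>) * (1 - e + (real N)\<^sup>2 * e) = 2 * (1 - e)" "0 < sin \<theta>"
    and irr: "\<And>j::nat. 0 < j \<Longrightarrow> sin (real j * \<theta>) \<noteq> 0"
  shows "infinite {z. nonbirkhoff_periodic_orbit gam (of_int m / real N) z}"
proof
  define T where "T = {t. tau < t \<and> t < 2 * pi \<and> (\<exists>K. K mod N = 1 \<and> orb t K = real K * tau)}"
  assume fin: "finite {z. nonbirkhoff_periodic_orbit gam (of_int m / real N) z}"
  have "orbit ` T \<subseteq> {z. nonbirkhoff_periodic_orbit gam (of_int m / real N) z}"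
    unfolding T_def using nonbirkhoff_orbit by auto
  moreover have "inj_on orbit T"
  proof (rule inj_onI)
    fix s t assume st: "s \<in> T" "t \<in> T" "orbit s = orbit t"
    then have "gam (s / (2 * pi)) = gam (t / (2 * pi))"
      by (auto simp: gam_def orbit_def orbZ_def dest!: fun_cong[of _ _ 1])
    then have "s / (2 * pi) = t / (2 * pi)"
    proof (rule inj_onD[rotated])
      show "inj_on gam {0..<1}"
        using bounds_strictly_convex_gam by (simp add: bounds_strictly_convex_domain_def)
    qed (use st tau in \<open>auto simp: T_def\<close>)
    then show "s = t" by simp
  qed
  ultimately have finT: "finite T" using fin by (meson finite_imageD finite_subset)
  obtain K where K: "\<forall>t. t \<in> T \<longrightarrow> K t mod N = 1 \<and> orb t (K t) = real (K t) * tau"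
    by atomize_elim (rule choice, auto simp: T_def)
  define P where "P = prod K T"
  have N1: "1 < N" using N_ge by simp
  have "0 < K t" if "t \<in> T" for t using K that by (cases "K t") auto
  then have "0 < P" unfolding P_def by (intro prod_pos) auto
  \<comment> \<open>This index is 1 modulo \<open>N\<close>, and \<open>1\<close> less than it is a
    multiple of \<open>2 * K t\<close> for every \<open>t\<close> in \<open>T\<close>.\<close>
  then obtain k where k: "sin (real (1 + 2 * N * P * k) * \<theta>) < 0"
    using sin_progression_neg[OF irr, of "2 * N * P"] N1 by auto
  let ?L = "1 + 2 * N * P * k"
  obtain t where t: "tau < t" "t < 2 * pi" "orb t ?L = real ?L * tau"
    using ex_orb_eq[OF \<theta> k] by blast
  have "?L mod N = (1 + N * (2 * P * k)) mod N" by (simp add: ac_simps)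
  also have "\<dots> = 1" using N1 by (metis mod_mult_self2 mod_less)
  finally have tT: "t \<in> T" using t unfolding T_def by blast
  then have "K t dvd P" unfolding P_def using finT by (rule dvd_prodI[rotated])
  then obtain c where c: "P = K t * c" ..
  then have L: "int ?L = 1 + 2 * int (K t) * int (N * c * k)" by (simp add: ac_simps)
  \<comment> \<open>The new \<open>t\<close> belongs to \<open>T\<close> itself, so periodicity
    moves index \<open>?L\<close> back to 1; comparison with the prescribed value of
    \<open>orb t ?L\<close> leaves \<open>t = tau\<close>.\<close>
  have "orbZ t (int ?L) = orbZ t 1 + of_int (int ?L - 1) * tau"
    unfolding L add_diff_cancel_left'
    by (rule orbZ_periodic_iterate) (use K tT t tau in auto)
  then have "orb t ?L = t + (real ?L - 1) * tau"
    unfolding orbZ_of_nat by (simp add: orbZ_def)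
  with t show False by (simp add: algebra_simps)
qed

end

theorem mainTheorem5:
  fixes m n :: int and \<rho> \<epsilon> :: real
  assumes "coprime m n" and "1 \<le> m" and "m \<le> n - 1"
    and "\<rho> > 0" and "\<epsilon> > 0"
  shows "\<exists>\<gamma> :: real \<Rightarrow> real \<times> real.
           holo_close_to_circle \<gamma> \<rho> \<epsilon> \<and>
           bounds_strictly_convex_domain \<gamma> \<and>
           infinite {z. nonbirkhoff_periodic_orbit \<gamma> (real_of_int m / real_of_int n) z}"
proof -
  define N where "N = nat n"
  have N: "int N = n" "2 \<le> real N" using assms by (auto simp: N_def)
  define A where "A = real N ^ 3 + real N ^ 2 + 1"
  define X where "X = 2 * (1 + real N) * exp (2 * pi * (1 + real N) * \<rho>)"
  have pos: "0 < A" "0 < X" unfolding A_def X_def using N by (auto intro!: add_nonneg_pos)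
  \<comment> \<open>The three bounds ensure that \<theta> is below \<open>pi\<close>, that
    \<open>e\<close> satisfies the smallness condition of the locale, and that the curve is close to
    the circle. All of this works because \<open>e\<close> will be at most \<theta>.\<close>
  define d where "d = min 1 (min (1 / (2 * A)) (\<epsilon> / X))"
  have "0 < d" unfolding d_def using pos assms by simp
  then obtain \<theta> where \<theta>: "0 < \<theta>" "\<theta> < d" and irr: "\<And>j::nat. 0 < j \<Longrightarrow> sin (real j * \<theta>) \<noteq> 0"
    using ex_small_nonresonant_angle by blast
  have d: "d \<le> 1" "d \<le> 1 / (2 * A)" "d \<le> \<epsilon> / X" unfolding d_def by auto
  have \<theta>pi: "\<theta> < pi" using \<theta> d pi_gt3 by simp
  define C where "C = (cos (\<theta> / 2))\<^sup>2"
  define D where "D = 1 + C * ((real N)\<^sup>2 - 1)"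
  have N2: "1 \<le> (real N)\<^sup>2" using N(2) by (intro one_le_power) simp
  then have D: "1 \<le> D" by (simp add: D_def C_def)
  \<comment> \<open>The angle is chosen first; this \<open>e\<close> solves the linear equation
    \<open>(1 + cos \<theta>) * (1 - e + N^2 * e) = 2 * (1 - e)\<close>, after writing
    \<open>1 + cos \<theta> = 2 * C\<close>.\<close>
  define e where "e = (sin (\<theta> / 2))\<^sup>2 / D"
  have "0 < sin (\<theta> / 2)" using \<theta> \<theta>pi by (intro sin_gt_zero) auto
  then have e_pos: "0 < e" unfolding e_def using D by simp
  have "(sin (\<theta> / 2))\<^sup>2 \<le> \<theta>"
  proof -
    have "(sin (\<theta> / 2))\<^sup>2 \<le> sin (\<theta> / 2) * 1"
      unfolding power2_eq_square using \<open>0 < sin (\<theta> / 2)\<close> by (intro mult_left_mono) auto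
    also have "\<dots> \<le> \<theta>" using sin_x_le_x[of "\<theta> / 2"] \<theta> by simp
    finally show ?thesis .
  qed
  moreover have "e \<le> (sin (\<theta> / 2))\<^sup>2 / 1"
    unfolding e_def using D by (intro divide_left_mono) auto
  ultimately have e_less: "e < d" using \<theta> by simp
  have small: "e * A \<le> 1 / 2"
  proof -
    have "e < 1 / (2 * A)" using e_less d by linarith
    then show ?thesis using pos by (simp add: field_simps)
  qed
  interpret flower N m e
    by unfold_locales (use assms N e_pos small in \<open>auto simp: A_def\<close>)
  have CS: "(sin (\<theta> / 2))\<^sup>2 = 1 - C" unfolding C_def by (simp add: sin_squared_eq)
  have "1 + cos \<theta> = 2 * C" using cos_double_cos[of "\<theta> / 2"] by (simp add: C_def)
  moreover have "e * D = 1 - C" unfolding e_def CS using D by simp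
  ultimately have "(1 + cos \<theta>) * (1 - e + (real N)\<^sup>2 * e) = 2 * (1 - e)"
    unfolding D_def by algebra
  moreover have "0 < sin \<theta>" using \<theta> \<theta>pi by (intro sin_gt_zero)
  ultimately have "infinite {z. nonbirkhoff_periodic_orbit gam (of_int m / real N) z}"
    using irr by (rule infinite_nonbirkhoff)
  moreover have "real N = of_int n" using N(1) by (metis of_int_of_nat_eq)
  moreover have "holo_close_to_circle gam \<rho> \<epsilon>"
  proof (rule holo_close_gam)
    have "e < \<epsilon> / X" using e_less d by linarith
    then have "e * X < \<epsilon>" using pos by (simp add: field_simps)
    then show "2 * e * (1 + real N) * exp (2 * pi * (1 + real N) * \<rho>) < \<epsilon>"
      by (simp add: X_def mult_ac)
  qed
  ultimately show ?thesis using bounds_strictly_convex_gam by auto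
qed

end
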